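(* Let $u$ be the solution of the transformed elliptic problem on $\Omega$, let $\eta$ be the solution of the adjoint problem, and for $i\ge1$ let $U^{(i)}$, with $U^{(i)}|_{\Omega_d}=U_d^{(i)}$, be the $i$-th iterate of the discrete Lions non-overlapping domain decomposition algorithm with parameter $\lambda\ge0$ (all defined in the context). Then the error in the quantity of interest $Q$ at iteration $i$ is represented as $$Q(u-U^{(i)})=DE^{(i)}+IE^{(i)}+CE^{(i)},$$ where $$DE^{(i)}=\sum_{d=1}^D\Big[(F,\eta)_d-(\mathbf A_d\nabla U_d^{(i)},\nabla\eta)_d+\sum_{\tilde d\in d'}\big\langle-\lambda U_d^{(i)}+\lambda U_{\tilde d}^{(i-1)}-\mathbf n_{\tilde d}\cdot\mathbf A_{\tilde d}\nabla U_{\tilde d}^{(i-1)},\,\eta\big\rangle_{d\cap\tilde d}\Big],$$ $$IE^{(i)}=\sum_{d=1}^D\sum_{\tilde d\in d'}\Big(\big\langle\lambda U_d^{(i)}-\lambda U_d^{(i-1)},\,\eta\big\rangle_{d\cap\tilde d}+\big\langle\mathbf n_d\cdot\mathbf A_d\nabla U_d^{(i-1)}-\mathbf n_d\cdot\mathbf A_d\nabla U_d^{(i)},\,\eta\big\rangle_{d\cap\tilde d}\Big),$$ $$CE^{(i)}=\frac12\sum_{d=1}^D\sum_{\tilde d\in d'}\Big(\big\langle\mathbf n_d\cdot\mathbf A_d\nabla U_d^{(i)}-\mathbf n_d\cdot\mathbf A_{\tilde d}\nabla U_{\tilde d}^{(i)},\,\eta\big\rangle_{d\cap\tilde d}+\big\langle\mathbf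 n_d\cdot\mathbf A_d\nabla\eta,\,U_d^{(i)}-U_{\tilde d}^{(i)}\big\rangle_{d\cap\tilde d}\Big).$$
   Context: Domains and maps. $\Omega\subset\mathbb{R}^2$ is a bounded convex polygonal reference domain, and $\Omega(\boldsymbol\theta)$ is the polygonal domain obtained from $\Omega$ by perturbing its boundary nodes by a fixed sample $\boldsymbol\theta$; both are contained in a convex polygonal domain $\Omega^*$. $\overline\Omega=\bigcup_{d=1}^D\overline{\Omega_d}$, where the $\Omega_d$ are non-intersecting non-degenerate open triangles such that no vertex of a triangle lies in the interior of an edge of another triangle or of a boundary edge. Perturbing only the vertices on $\partial\Omega$ gives a corresponding partition of $\Omega(\boldsymbol\theta)$ into non-degenerate triangles $\Omega_d(\boldsymbol\theta)$. $\varphi_d:\Omega_d(\boldsymbol\theta)\to\Omega_d$ is the invertible affine map taking vertices to corresponding vertices, with constant Jacobian matrix $\mathbf J_d$. Data. $a$ is a symmetric positive definite $2\times2$ matrix function, continuous on $\Omega^*$, with $w^\top a(x)w\ge a_0\|w\|^2$ for some $a_0>0$ and all $w\in\mathbb R^2$, $x\in\Omega^*$; $f$ is continuous on $\Omega^*$; $\psi\in L^2(\Omega^* )$. For $y\in\Omega_d$ set $$\mathbf A(y)=\mathbf A_d(y)=|\det\mathbf J_d|^{-1}\mathbf J_d\,a(\varphi_d^{-1}(y))\,\mathbf J_d^\top,\quad F(y)=F_d(y)=|\det\mathbf J_d|^{-1}f(\varphi_d^{-1}(y)),\quad \tilde\psi(y)=|\det\mathbf J_d|^{-1}\psi(\varphi_d^{-1}(y)).$$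 Notation. $\mathbf n_d$ is the outward unit normal to $\Omega_d$, so $\mathbf n_{\tilde d}=-\mathbf n_d$ on $\partial\Omega_d\cap\partial\Omega_{\tilde d}$. $d'$ is the set of indices $\tilde d\in\{1,\dots,D\}\setminus\{d\}$ such that $\Omega_d$ and $\Omega_{\tilde d}$ share a boundary (a common edge). For scalar or vector functions (with the dot product in the vector case), $$(f,g)_d=\int_{\Omega_d}f\,g\,dy,\qquad\langle f,g\rangle_{d\cap\tilde d}=\int_{\partial\Omega_d\cap\partial\Omega_{\tilde d}}f\,g\,ds.$$ In interface terms, functions and fluxes with subscript $d$ (respectively $\tilde d$) are traces taken from $\Omega_d$ (respectively $\Omega_{\tilde d}$). Transformed problem. $u\in H_0^1(\Omega)$ solves $-\nabla\cdot(\mathbf A\nabla u)=F$ in $\Omega$, $u=0$ on $\partial\Omega$, i.e. $\int_\Omega\mathbf A\nabla u\cdot\nabla v\,dy=\int_\Omega F v\,dy$ for all $v\in H_0^1(\Omega)$. Adjoint problem. $\eta$ solves $-\nabla\cdot(\mathbf A\nabla\eta)=\tilde\psi$ in $\Omega$, $\eta=0$ on $\partial\Omega$. The problems are understood as equivalent to their subdomain formulations: the equation holds in each $\Omega_d$, and the solution and its normal flux are continuous across interfaces, e.g. $\mathbf n_d\cdot\mathbf A_d\nabla\eta=-\mathbf n_{\tilde d}\cdot\mathbf A_{\tilde d}\nabla\eta$ on $\partial\Omega_d\cap\partial\Omega_{\tilde d}$ for $\tilde d\in d'$. The solutions are taken regular enough that the interface integrals in the claim are well defined and that integration by parts on each $\Omega_d$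 is valid. Quantity of interest. $Q(v)=\int_\Omega v\,\tilde\psi\,dy=\sum_{d=1}^D(v_d,\tilde\psi)_d$ for a (possibly discontinuous across interfaces) function $v$ with $v|_{\Omega_d}=v_d$. Discrete Lions algorithm. $\mathcal T_h$ is a conforming triangulation of $\Omega$ refining $\{\Omega_d\}$, and $\mathcal T_h^d$ is its restriction to $\Omega_d$. $V_h(\Omega_d)\subset H^1(\Omega_d)$ is the space of continuous piecewise linear functions on $\mathcal T_h^d$ that vanish on $\partial\Omega_d\cap\partial\Omega$. Given initial guesses $U_d^{(0)}\in V_h(\Omega_d)$, $1\le d\le D$, and fixed $\lambda\ge0$, the iterates $U_d^{(i)}\in V_h(\Omega_d)$, $i=1,2,\dots,I$, satisfy $$(\mathbf A_d\nabla U_d^{(i)},\nabla v)_d+\sum_{\tilde d\in d'}\lambda\langle U_d^{(i)},v\rangle_{d\cap\tilde d}=(F_d,v)_d+\sum_{\tilde d\in d'}\Big(\lambda\langle U_{\tilde d}^{(i-1)},v\rangle_{d\cap\tilde d}-\langle\mathbf n_{\tilde d}\cdot\mathbf A_{\tilde d}\nabla U_{\tilde d}^{(i-1)},v\rangle_{d\cap\tilde d}\Big)$$ for all $v\in V_h(\Omega_d)$. *)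

theory Defs
  imports "HOL-Analysis.Analysis"
begin

section \<open>Polygonal domains and triangulations\<close>

definition convex_polygonal_domain :: "(real^2) set \<Rightarrow> bool" where
  "convex_polygonal_domain S \<longleftrightarrow> open S \<and> convex S \<and> S \<noteq> {} \<and> polytope (closure S)"

text \<open>A triangle is represented by the set \<open>K\<close> of its three vertices; the open triangle is
  \<open>tri K\<close>, the closed one is \<open>convex hull K\<close>.\<close>

definition nondegenerate_triangle :: "(real^2) set \<Rightarrow> bool" where
  "nondegenerate_triangle K \<longleftrightarrow> card K = 3 \<and> \<not> affine_dependent K"

definition tri :: "(real^2) set \<Rightarrow> (real^2) set" where
  "tri K = interior (convex hull K)"

definition edges :: "(real^2) set \<Rightarrow> (real^2) set set" where
  "edges K = {closed_segment p q | p q. p \<in> K \<and> q \<in> K \<and> p \<noteq> q}"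

definition triangle_partition :: "(real^2) set \<Rightarrow> (real^2) set set \<Rightarrow> bool" where
  "triangle_partition S \<K> \<longleftrightarrow>
     finite \<K> \<and> (\<forall>K\<in>\<K>. nondegenerate_triangle K) \<and>
     closure S = (\<Union>K\<in>\<K>. convex hull K) \<and>
     (\<forall>K\<in>\<K>. \<forall>L\<in>\<K>. K \<noteq> L \<longrightarrow> tri K \<inter> tri L = {})"

text \<open>Boundary edges are the edges of triangles that lie on the boundary of \<open>S\<close>, so that nodes with
  a straight angle are allowed on the boundary.\<close>

definition conforming_triangulation :: "(real^2) set \<Rightarrow> (real^2) set set \<Rightarrow> bool" where
  "conforming_triangulation S \<K> \<longleftrightarrow>
     triangle_partition S \<K> \<and>
     (\<forall>K\<in>\<K>. \<forall>p\<in>K.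
        (\<forall>L\<in>\<K> - {K}. \<forall>e\<in>edges L. p \<notin> rel_interior e) \<and>
        (\<forall>L\<in>\<K>. \<forall>e\<in>edges L. e \<subseteq> frontier S \<longrightarrow> p \<notin> rel_interior e))"

definition mesh_refines :: "(real^2) set set \<Rightarrow> (real^2) set set \<Rightarrow> bool" where
  "mesh_refines \<T> \<K> \<longleftrightarrow> (\<forall>L\<in>\<T>. \<exists>K\<in>\<K>. convex hull L \<subseteq> convex hull K)"

definition perturbed_node :: "(real^2) set \<Rightarrow> (real^2 \<Rightarrow> real^2) \<Rightarrow> real^2 \<Rightarrow> real^2" where
  "perturbed_node S \<theta> p = (if p \<in> frontier S then p + \<theta> p else p)"

text \<open>For an indexed family of vertex sets \<open>K 1, ..., K D\<close>: the indices of the subdomains that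
  have an edge in common with subdomain \<open>d\<close>, and the interfaces.\<close>

definition nbrs :: "nat \<Rightarrow> (nat \<Rightarrow> (real^2) set) \<Rightarrow> nat \<Rightarrow> nat set" where
  "nbrs D K d = {d' \<in> {1..D} - {d}. edges (K d) \<inter> edges (K d') \<noteq> {}}"

definition iface :: "(nat \<Rightarrow> (real^2) set) \<Rightarrow> nat \<Rightarrow> nat \<Rightarrow> (real^2) set" where
  "iface K d d' = frontier (tri (K d)) \<inter> frontier (tri (K d'))"

text \<open>The outward unit normal on an edge \<open>e\<close> of the open triangle \<open>T\<close>. Since \<open>e\<close> lies in the
  closure of \<open>T\<close>, the inequality forces orthogonality to \<open>e\<close>.\<close>

definition outward_normal :: "(real^2) set \<Rightarrow> (real^2) set \<Rightarrow> real^2" where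
  "outward_normal T e = (THE \<nu>. norm \<nu> = 1 \<and> (\<forall>x\<in>e. \<forall>y\<in>T. \<nu> \<bullet> (y - x) \<le> 0))"

text \<open>The function on \<open>S\<close> given by \<open>g d\<close> on \<open>tri (K d)\<close>; it is set to zero off the open
  triangles, i.e. on a null set.\<close>

definition glue :: "nat \<Rightarrow> (nat \<Rightarrow> (real^2) set) \<Rightarrow> (nat \<Rightarrow> real^2 \<Rightarrow> 'b::zero) \<Rightarrow> real^2 \<Rightarrow> 'b" where
  "glue D K g y =
     (if \<exists>d\<in>{1..D}. y \<in> tri (K d) then g (THE d. d \<in> {1..D} \<and> y \<in> tri (K d)) y else 0)"


section \<open>Integrals over subdomains and edges\<close>

text \<open>Arc length on a segment: the image of Lebesgue measure under the unit speed
  parametrization. The choice of the orientation is immaterial.\<close>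

definition arclength :: "(real^2) set \<Rightarrow> (real^2) measure" where
  "arclength e =
     (let (p, q) = (SOME pq. e = closed_segment (fst pq) (snd pq)) in
        distr (restrict_space lborel {0..dist p q}) (restrict_space borel e)
          (\<lambda>s. p + (s / dist p q) *\<^sub>R (q - p)))"

definition dom_pair :: "(real^2) set \<Rightarrow> (real^2 \<Rightarrow> 'b::real_inner) \<Rightarrow> (real^2 \<Rightarrow> 'b) \<Rightarrow> real" where
  "dom_pair T f g = (\<integral>y. f y \<bullet> g y \<partial>lebesgue_on T)"

definition edge_pair :: "(real^2) set \<Rightarrow> (real^2 \<Rightarrow> real) \<Rightarrow> (real^2 \<Rightarrow> real) \<Rightarrow> real" where
  "edge_pair e f g = (\<integral>x. f x * g x \<partial>arclength e)"

definition L2 :: "'a measure \<Rightarrow> ('a \<Rightarrow> 'b::euclidean_space) \<Rightarrow> bool" where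
  "L2 M f \<longleftrightarrow> f \<in> borel_measurable M \<and> integrable M (\<lambda>x. (norm (f x))\<^sup>2)"

definition L2_tendsto ::
    "'a measure \<Rightarrow> (nat \<Rightarrow> 'a \<Rightarrow> 'b::euclidean_space) \<Rightarrow> ('a \<Rightarrow> 'b) \<Rightarrow> bool" where
  "L2_tendsto M f g \<longleftrightarrow> (\<forall>k. L2 M (f k)) \<and> L2 M g \<and>
     (\<lambda>k. \<integral>x. (norm (f k x - g x))\<^sup>2 \<partial>M) \<longlonglongrightarrow> 0"


section \<open>Sobolev spaces, traces and normal traces\<close>

definition partial :: "2 \<Rightarrow> (real^2 \<Rightarrow> real) \<Rightarrow> real^2 \<Rightarrow> real" where
  "partial i f x = frechet_derivative f (at x) (axis i 1)"

definition grad :: "(real^2 \<Rightarrow> real) \<Rightarrow> real^2 \<Rightarrow> real^2" where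
  "grad f x = (\<chi> i. partial i f x)"

text \<open>Smooth functions with compact support in \<open>S\<close>; smoothness means that all iterated partial
  derivatives are (totally) differentiable.\<close>

definition test_fun :: "(real^2) set \<Rightarrow> (real^2 \<Rightarrow> real) \<Rightarrow> bool" where
  "test_fun S \<phi> \<longleftrightarrow>
     (\<forall>js x. foldr partial js \<phi> differentiable (at x)) \<and>
     compact (closure {x. \<phi> x \<noteq> 0}) \<and> closure {x. \<phi> x \<noteq> 0} \<subseteq> S"

text \<open>\<open>v\<close> belongs to the Sobolev space of order one on \<open>S\<close>, with weak gradient \<open>g\<close>.\<close>

definition H1_grad :: "(real^2) set \<Rightarrow> (real^2 \<Rightarrow> real) \<Rightarrow> (real^2 \<Rightarrow> real^2) \<Rightarrow> bool" where
  "H1_grad S v g \<longleftrightarrow> L2 (lebesgue_on S) v \<and> L2 (lebesgue_on S) g \<and>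
     (\<forall>\<phi> j. test_fun S \<phi> \<longrightarrow>
        (\<integral>x. v x * partial j \<phi> x \<partial>lebesgue_on S) = - (\<integral>x. g x $ j * \<phi> x \<partial>lebesgue_on S))"

definition wgrad :: "(real^2) set \<Rightarrow> (real^2 \<Rightarrow> real) \<Rightarrow> real^2 \<Rightarrow> real^2" where
  "wgrad S v = (SOME g. H1_grad S v g)"

text \<open>The closure of the test functions in the first-order Sobolev space.\<close>

definition H10 :: "(real^2) set \<Rightarrow> (real^2 \<Rightarrow> real) set" where
  "H10 S = {v. \<exists>g. H1_grad S v g \<and>
     (\<exists>\<phi>. (\<forall>k. test_fun S (\<phi> k)) \<and>
        L2_tendsto (lebesgue_on S) \<phi> v \<and> L2_tendsto (lebesgue_on S) (\<lambda>k. grad (\<phi> k)) g)}"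

text \<open>\<open>t\<close> is the trace on the boundary of \<open>tri K\<close> of the first-order Sobolev function \<open>v\<close>: the
  continuous extension of the restriction map from Sobolev functions continuous up to the boundary.\<close>

definition has_trace :: "(real^2) set \<Rightarrow> (real^2 \<Rightarrow> real) \<Rightarrow> (real^2 \<Rightarrow> real) \<Rightarrow> bool" where
  "has_trace K v t \<longleftrightarrow>
     (\<exists>g \<phi> G. H1_grad (tri K) v g \<and>
        (\<forall>k. H1_grad (tri K) (\<phi> k) (G k) \<and> continuous_on (closure (tri K)) (\<phi> k)) \<and>
        L2_tendsto (lebesgue_on (tri K)) \<phi> v \<and> L2_tendsto (lebesgue_on (tri K)) G g \<and>
        (\<forall>e\<in>edges K. L2_tendsto (arclength e) \<phi> t))"

text \<open>The square integrable field \<open>\<sigma>\<close> has divergence \<open>\<delta>\<close> in \<open>tri K\<close> and (outward) normal trace \<open>q\<close>,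
  in the sense that integration by parts on \<open>tri K\<close> holds against every first-order Sobolev
  function \<open>v\<close> (with weak gradient \<open>g\<close> and trace \<open>t\<close>).\<close>

definition has_normal_trace ::
    "(real^2) set \<Rightarrow> (real^2 \<Rightarrow> real^2) \<Rightarrow> (real^2 \<Rightarrow> real) \<Rightarrow> (real^2 \<Rightarrow> real) \<Rightarrow> bool" where
  "has_normal_trace K \<sigma> \<delta> q \<longleftrightarrow>
     L2 (lebesgue_on (tri K)) \<sigma> \<and> L2 (lebesgue_on (tri K)) \<delta> \<and> (\<forall>e\<in>edges K. L2 (arclength e) q) \<and>
     (\<forall>v g t. H1_grad (tri K) v g \<and> has_trace K v t \<longrightarrow>
        dom_pair (tri K) \<sigma> g + dom_pair (tri K) \<delta> v = (\<Sum>e\<in>edges K. edge_pair e q t))"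

text \<open>The weak form of the homogeneous Dirichlet problem for \<open>-div (A grad u) = F\<close> on \<open>S\<close>.\<close>

definition weak_solution ::
    "(real^2) set \<Rightarrow> (real^2 \<Rightarrow> real^2^2) \<Rightarrow> (real^2 \<Rightarrow> real) \<Rightarrow> (real^2 \<Rightarrow> real) \<Rightarrow> bool" where
  "weak_solution S A F u \<longleftrightarrow> u \<in> H10 S \<and>
     (\<forall>v\<in>H10 S.
        integrable (lebesgue_on S) (\<lambda>y. (A y *v wgrad S u y) \<bullet> wgrad S v y) \<and>
        integrable (lebesgue_on S) (\<lambda>y. F y * v y) \<and>
        (\<integral>y. (A y *v wgrad S u y) \<bullet> wgrad S v y \<partial>lebesgue_on S) =
        (\<integral>y. F y * v y \<partial>lebesgue_on S))"


section \<open>Transformed data\<close>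

definition transformed_matrix ::
    "real^2^2 \<Rightarrow> (real^2 \<Rightarrow> real^2) \<Rightarrow> (real^2 \<Rightarrow> real^2^2) \<Rightarrow> real^2 \<Rightarrow> real^2^2" where
  "transformed_matrix J \<phi> a y = (1 / \<bar>det J\<bar>) *\<^sub>R (J ** a (inv \<phi> y) ** transpose J)"

definition transformed_scalar ::
    "real^2^2 \<Rightarrow> (real^2 \<Rightarrow> real^2) \<Rightarrow> (real^2 \<Rightarrow> real) \<Rightarrow> real^2 \<Rightarrow> real" where
  "transformed_scalar J \<phi> f y = (1 / \<bar>det J\<bar>) * f (inv \<phi> y)"

definition qoi :: "(real^2) set \<Rightarrow> (real^2 \<Rightarrow> real) \<Rightarrow> (real^2 \<Rightarrow> real) \<Rightarrow> real" where
  "qoi S \<psi> v = (\<integral>y. v y * \<psi> y \<partial>lebesgue_on S)"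


section \<open>The discrete Lions algorithm\<close>

text \<open>Continuous piecewise linear functions on the part of the mesh \<open>\<T>\<close> (a set of vertex sets) inside
  the triangle \<open>K\<close>, vanishing on the common boundary with \<open>S\<close>. Only values on the closed triangle
  are constrained. Their gradient is the classical \<^const>\<open>grad\<close>, defined inside the mesh triangles.\<close>

definition Vh :: "(real^2) set \<Rightarrow> (real^2) set set \<Rightarrow> (real^2) set \<Rightarrow> (real^2 \<Rightarrow> real) set" where
  "Vh S \<T> K = {v. continuous_on (closure (tri K)) v \<and>
     (\<forall>L\<in>\<T>. convex hull L \<subseteq> closure (tri K) \<longrightarrow>
        (\<exists>b c. \<forall>x\<in>convex hull L. v x = b \<bullet> x + c)) \<and>
     (\<forall>x\<in>frontier (tri K) \<inter> frontier S. v x = 0)}"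

text \<open>The trace of \<open>A grad v\<close> taken from inside \<open>T\<close>. For \<open>v\<close> in \<^const>\<open>Vh\<close> and continuous \<open>A\<close> the limit
  exists at all points of the edges of \<open>T\<close> except possibly mesh vertices.\<close>

definition flux_trace ::
    "(real^2) set \<Rightarrow> (real^2 \<Rightarrow> real^2^2) \<Rightarrow> (real^2 \<Rightarrow> real) \<Rightarrow> real^2 \<Rightarrow> real^2" where
  "flux_trace T A v x = Lim (at x within T) (\<lambda>y. A y *v grad v y)"

definition lions_step ::
    "(real^2) set \<Rightarrow> nat \<Rightarrow> (nat \<Rightarrow> (real^2) set) \<Rightarrow> (real^2) set set \<Rightarrow>
     (nat \<Rightarrow> real^2 \<Rightarrow> real^2^2) \<Rightarrow> (nat \<Rightarrow> real^2 \<Rightarrow> real) \<Rightarrow> real \<Rightarrow>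
     (nat \<Rightarrow> real^2 \<Rightarrow> real) \<Rightarrow> (nat \<Rightarrow> real^2 \<Rightarrow> real) \<Rightarrow> bool" where
  "lions_step S D K \<T> A F lam W U \<longleftrightarrow>
     (\<forall>d\<in>{1..D}. U d \<in> Vh S \<T> (K d) \<and>
       (\<forall>v\<in>Vh S \<T> (K d).
          dom_pair (tri (K d)) (\<lambda>y. A d y *v grad (U d) y) (grad v)
            + (\<Sum>d'\<in>nbrs D K d. lam * edge_pair (iface K d d') (U d) v)
          = dom_pair (tri (K d)) (F d) v
            + (\<Sum>d'\<in>nbrs D K d.
                 lam * edge_pair (iface K d d') (W d') v
                 - edge_pair (iface K d d')
                     (\<lambda>x. outward_normal (tri (K d')) (iface K d d') \<bullet>
                            flux_trace (tri (K d')) (A d') (W d') x) v)))"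

end

theory Submission
  imports Defs
begin

text \<open>Both weak forms and the symmetry of \<open>A\<close> give \<open>Q(u) = \<Sum>\<^sub>d (F, \<eta>)\<^sub>d\<close>. Green's formula for the flux of
  \<open>\<eta>\<close> against the discrete function \<open>U\<^sub>d\<close> gives \<open>(U\<^sub>d, \<psi>)\<^sub>d = (A \<nabla>U\<^sub>d, \<nabla>\<eta>)\<^sub>d\<close> minus the integrals of \<open>U\<^sub>d\<close> times
  the normal flux of \<open>\<eta>\<close> over the interfaces; the rest of the boundary does not contribute. All remaining
  interface terms cancel when the two sides of each interface are exchanged, since the trace of \<open>\<eta>\<close> is
  continuous while its normal flux and the normals change sign. Here the
  interfaces exhaust the interior edges: an edge that is not on the boundary is shared
  with exactly one further triangle, which lies on its other side.\<close>

section \<open>Triangles and their edges\<close>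

text \<open>The geometry is localised at relatively interior points of edges: a triangle is a half
  disc there, so two disjoint triangles whose edges meet at such a point have opposite normals.
  Normals, interfaces and neighbours are all treated with this picture.
  \<open>has_normal_trace\<close> can be tested only with weakly differentiable functions that have
  a trace, whereas the discrete functions come with the classical \<open>grad\<close>; hence the
  effort of showing that a function affine on finitely many closed convex pieces has its classical
  gradient as weak gradient. The traces of \<eta> from the two sides of an interface agree only
  almost everywhere. Exchanging them in an integral against a discrete flux, which is a pointwise
  \<open>Lim\<close>, calls for measurability of that flux. The factor 1/2 in the consistency error
  reflects that its summand is symmetric under the exchange of \<open>d\<close> and
  \<open>d'\<close>: every interface is counted twice with the same value.\<close>

lemma tri_convex_hull:
  assumes "nondegenerate_triangle K"
  shows "open (tri K)" "convex (tri K)" "tri K \<subseteq> convex hull K" "closure (tri K) = convex hull K"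
proof -
  have fin: "finite K"
    using assms by (auto simp: nondegenerate_triangle_def card_ge_0_finite)
  have card: "card K = Suc (DIM(real^2))" and ind: "\<not> affine_dependent K"
    using assms by (auto simp: nondegenerate_triangle_def)
  have ne: "interior (convex hull K) \<noteq> {}"
    using interior_convex_hull_eq_empty[OF card] ind by simp
  show "open (tri K)" "convex (tri K)" "tri K \<subseteq> convex hull K"
    by (auto simp: tri_def interior_subset convex_interior)
  have cl: "closed (convex hull K)"
    by (simp add: fin compact_imp_closed finite_imp_compact_convex_hull)
  show "closure (tri K) = convex hull K"
    using convex_closure_interior[OF convex_convex_hull ne] cl by (simp add: tri_def)
qed

lemma nondegenerate_triangle_3:
  assumes "nondegenerate_triangle K" "e \<in> edges K"
  obtains p q r where "K = {p, q, r}" "p \<noteq> q" "p \<noteq> r" "q \<noteq> r" "e = closed_segment p q"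
    "\<not> collinear {p, q, r}"
proof -
  obtain p q where pq: "e = closed_segment p q" "p \<in> K" "q \<in> K" "p \<noteq> q"
    using assms(2) by (auto simp: edges_def)
  have "card K = 3" using assms(1) by (simp add: nondegenerate_triangle_def)
  then have fin: "finite K" and "card (K - {p, q}) = 1"
    using pq by (auto simp: card_ge_0_finite card_Diff_subset)
  then obtain r where r: "K - {p, q} = {r}" by (auto simp: card_1_singleton_iff)
  then have K: "K = {p, q, r}" "p \<noteq> r" "q \<noteq> r" using pq by auto
  moreover have "\<not> collinear {p, q, r}"
    using assms(1) K pq by (auto simp: nondegenerate_triangle_def collinear_3_eq_affine_dependent)
  ultimately show ?thesis using that pq by blast
qed

section \<open>Signed areas and barycentric coordinates in the plane\<close>

definition cross2 :: "real^2 \<Rightarrow> real^2 \<Rightarrow> real" where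
  "cross2 v w = v $ 1 * w $ 2 - v $ 2 * w $ 1"

text \<open>The disjunction is the library's normal form for collinearity of \<open>0\<close>,
  \<open>a\<close>, \<open>b\<close>, so that collinearity of three points can be rewritten into the
  vanishing of a signed area.\<close>

lemma cross2_eq_0_iff: "cross2 a b = 0 \<longleftrightarrow> a = 0 \<or> b = 0 \<or> (\<exists>c. b = c *\<^sub>R a)" (is "?l \<longleftrightarrow> ?r")
proof
  assume ?r
  then show ?l by (auto simp: cross2_def)
next
  assume l: ?l
  show ?r
  proof (cases "a = 0")
    case False
    then consider "a $ 1 \<noteq> 0" | "a $ 2 \<noteq> 0"
      by (auto simp: vec_eq_iff forall_2)
    then show ?thesis
    proof cases
      case 1
      then have "b = (b $ 1 / a $ 1) *\<^sub>R a"
        using l by (simp add: vec_eq_iff forall_2 cross2_def field_simps)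
      then show ?thesis by blast
    next
      case 2
      then have "b = (b $ 2 / a $ 2) *\<^sub>R a"
        using l by (simp add: vec_eq_iff forall_2 cross2_def field_simps)
      then show ?thesis by blast
    qed
  qed simp
qed

lemma collinear_iff_cross2: "collinear {p, q, r} \<longleftrightarrow> cross2 (q - p) (r - p) = 0"
  using collinear_3[of q p r] collinear_lemma[of "q - p" "r - p"]
  unfolding cross2_eq_0_iff by (simp add: insert_commute)

text \<open>Cramer's rule: the weight of a vertex is the signed area of the triangle formed by
  \<open>y\<close> and the opposite edge, relative to that of the whole triangle. Cleared of
  denominators, both claims are polynomial identities.\<close>

lemma barycentric:
  fixes p q r y :: "real^2"
  defines "\<Delta> \<equiv> cross2 (q - p) (r - p)"
  assumes "\<Delta> \<noteq> 0"
  shows "y = (cross2 (r - q) (y - q) / \<Delta>) *\<^sub>R p + (cross2 (p - r) (y - r) / \<Delta>) *\<^sub>R q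
             + (cross2 (q - p) (y - p) / \<Delta>) *\<^sub>R r" (is "y = ?R")
    and "cross2 (r - q) (y - q) / \<Delta> + cross2 (p - r) (y - r) / \<Delta> + cross2 (q - p) (y - p) / \<Delta> = 1"
proof -
  have "\<Delta> *\<^sub>R y = cross2 (r - q) (y - q) *\<^sub>R p + cross2 (p - r) (y - r) *\<^sub>R q + cross2 (q - p) (y - p) *\<^sub>R r"
    unfolding \<Delta>_def cross2_def by (simp add: vec_eq_iff forall_2 algebra_simps)
  then have "(1 / \<Delta>) *\<^sub>R (\<Delta> *\<^sub>R y) =
      (1 / \<Delta>) *\<^sub>R (cross2 (r - q) (y - q) *\<^sub>R p + cross2 (p - r) (y - r) *\<^sub>R q + cross2 (q - p) (y - p) *\<^sub>R r)"
    by simp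
  then show "y = ?R" using assms(2) by (simp add: scaleR_add_right)
  show "cross2 (r - q) (y - q) / \<Delta> + cross2 (p - r) (y - r) / \<Delta> + cross2 (q - p) (y - p) / \<Delta> = 1"
    using assms(2) unfolding \<Delta>_def cross2_def add_divide_distrib[symmetric]
    by (subst divide_eq_1_iff) (auto simp: algebra_simps)
qed

text \<open>The last clause says that near a relatively interior point of the edge \<open>e\<close> the triangle is a half disc.\<close>

definition edge_normal :: "(real^2) set \<Rightarrow> (real^2) set \<Rightarrow> real^2 \<Rightarrow> real \<Rightarrow> bool" where
  "edge_normal K e \<nu> c \<longleftrightarrow> norm \<nu> = 1 \<and> (\<forall>y\<in>tri K. \<nu> \<bullet> y < c) \<and> (\<forall>y\<in>convex hull K. \<nu> \<bullet> y \<le> c) \<and>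
     {y \<in> convex hull K. \<nu> \<bullet> y = c} = e \<and>
     (\<forall>x\<in>rel_interior e. \<exists>\<epsilon>>0. \<forall>y. dist y x < \<epsilon> \<longrightarrow> \<nu> \<bullet> y < c \<longrightarrow> y \<in> tri K)"

text \<open>The barycentric coordinate of the vertex \<open>r\<close> opposite to \<open>e\<close>
  is a positive multiple of \<open>c - \<nu> \<bullet> y\<close>. All clauses are therefore read off
  from the sign of this coordinate, the other two being controlled by the point in question.\<close>

lemma edge_normal_exists:
  assumes "nondegenerate_triangle K" "e \<in> edges K"
  obtains \<nu> c where "edge_normal K e \<nu> c"
proof -
  obtain p q r where K: "K = {p, q, r}" and ne: "p \<noteq> q" "p \<noteq> r" "q \<noteq> r" and e: "e = closed_segment p q"
    and ncol: "\<not> collinear {p, q, r}"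
    using nondegenerate_triangle_3[OF assms] .
  define \<Delta> where "\<Delta> = cross2 (q - p) (r - p)"
  have \<Delta>: "\<Delta> \<noteq> 0" using ncol by (simp add: collinear_iff_cross2 \<Delta>_def)
  \<comment> \<open>This is minus the gradient of the barycentric coordinate of \<open>r\<close>.
    Division by the signed \<Delta> makes it point away from \<open>r\<close> for either orientation
    of the vertices.\<close>
  define m :: "real^2" where "m = (\<chi> i. if i = 1 then (q - p) $ 2 / \<Delta> else - ((q - p) $ 1) / \<Delta>)"
  have m12: "m $ 1 = (q - p) $ 2 / \<Delta>" "m $ 2 = - ((q - p) $ 1) / \<Delta>"
    by (simp_all add: m_def)
  have m_ne: "m \<noteq> 0"
  proof
    assume "m = 0"
    then have "m $ 1 = 0" "m $ 2 = 0" by auto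
    then have "q = p" using \<Delta> unfolding m12 by (auto simp: vec_eq_iff forall_2)
    then show False using ne by simp
  qed
  have l: "cross2 (q - p) (y - p) / \<Delta> = - (m \<bullet> (y - p))" for y
    unfolding cross2_def inner_vec_def sum_2 m12 by (simp add: field_simps \<Delta>)
  define \<nu> where "\<nu> = m /\<^sub>R norm m"
  define c where "c = \<nu> \<bullet> p"
  have nl: "cross2 (q - p) (y - p) / \<Delta> = norm m * (c - \<nu> \<bullet> y)" for y
    unfolding l c_def \<nu>_def using m_ne by (simp add: inner_diff_right field_simps)
  \<comment> \<open>Scaled by \<open>norm m\<close>, the distance to the line through
    \<open>p\<close> and \<open>q\<close> recovers the weight of \<open>r\<close>.\<close>
  have coord: "norm m * (c - \<nu> \<bullet> (u *\<^sub>R p + v *\<^sub>R q + w *\<^sub>R r)) = w" if "u + v + w = 1" for u v w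
  proof -
    have u: "u = 1 - v - w" using that by simp
    have "cross2 (q - p) (u *\<^sub>R p + v *\<^sub>R q + w *\<^sub>R r - p) = w * \<Delta>"
      unfolding u \<Delta>_def cross2_def by (simp add: algebra_simps)
    then show ?thesis using \<Delta> by (simp flip: nl)
  qed
  have tri: "tri K = {v. \<exists>x y z. 0 < x \<and> 0 < y \<and> 0 < z \<and> x + y + z = 1 \<and> x *\<^sub>R p + y *\<^sub>R q + z *\<^sub>R r = v}"
    unfolding tri_def K by (rule interior_convex_hull_3_minimal[OF ncol]) simp
  have hull: "convex hull K = {u *\<^sub>R p + v *\<^sub>R q + w *\<^sub>R r | u v w. 0 \<le> u \<and> 0 \<le> v \<and> 0 \<le> w \<and> u + v + w = 1}"
    unfolding K by (rule convex_hull_3)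
  have pos: "norm m > 0" using m_ne by simp
  have "norm \<nu> = 1" using m_ne by (simp add: \<nu>_def)
  moreover have "\<nu> \<bullet> y < c" if y: "y \<in> tri K" for y
  proof -
    obtain u v w where "y = u *\<^sub>R p + v *\<^sub>R q + w *\<^sub>R r" "u + v + w = 1" "w > 0" using y unfolding tri by blast
    then have "norm m * (c - \<nu> \<bullet> y) > 0" using coord by simp
    then show ?thesis using pos by (simp add: zero_less_mult_iff)
  qed
  moreover have "\<nu> \<bullet> y \<le> c" if y: "y \<in> convex hull K" for y
  proof -
    obtain u v w where "y = u *\<^sub>R p + v *\<^sub>R q + w *\<^sub>R r" "u + v + w = 1" "w \<ge> 0" using y unfolding hull by blast
    then have "norm m * (c - \<nu> \<bullet> y) \<ge> 0" using coord by simp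
    then show ?thesis using pos by (simp add: zero_le_mult_iff)
  qed
  moreover have "{y \<in> convex hull K. \<nu> \<bullet> y = c} = e"
  proof (intro equalityI subsetI)
    fix y assume "y \<in> {y \<in> convex hull K. \<nu> \<bullet> y = c}"
    then obtain u v w where y: "y = u *\<^sub>R p + v *\<^sub>R q + w *\<^sub>R r" "u + v + w = 1" "u \<ge> 0" "v \<ge> 0"
      and "\<nu> \<bullet> y = c"
      using hull by blast
    then have "w = 0" using coord[of u v w] by simp
    then have "u = 1 - v" using y by simp
    then show "y \<in> e" using y \<open>w = 0\<close> by (auto simp: e in_segment)
  next
    fix y assume y: "y \<in> e"
    then have "y \<in> convex hull K"
      unfolding e segment_convex_hull K using hull_mono[of "{p, q}" "{p, q, r}"] by blast
    moreover obtain v where v: "y = (1 - v) *\<^sub>R p + v *\<^sub>R q" using y by (auto simp: e in_segment)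
    ultimately show "y \<in> {y \<in> convex hull K. \<nu> \<bullet> y = c}"
      using coord[of "1 - v" v 0] m_ne by simp
  qed
  moreover have "\<exists>\<epsilon>>0. \<forall>y. dist y x < \<epsilon> \<longrightarrow> \<nu> \<bullet> y < c \<longrightarrow> y \<in> tri K" if x: "x \<in> rel_interior e" for x
  proof -
    obtain t where t: "x = (1 - t) *\<^sub>R p + t *\<^sub>R q" "0 < t" "t < 1"
      using x ne by (auto simp: e rel_interior_closed_segment in_segment)
    \<comment> \<open>The coordinates of \<open>p\<close> and \<open>q\<close> are positive at
      \<open>x\<close>, hence near \<open>x\<close> by continuity; the condition
      \<open>\<nu> \<bullet> y < c\<close> supplies positivity of the third one.\<close>
    define lp lq where "lp y = cross2 (r - q) (y - q) / \<Delta>" and "lq y = cross2 (p - r) (y - r) / \<Delta>" for y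
    have "cross2 (r - q) (x - q) = (1 - t) * \<Delta>" "cross2 (p - r) (x - r) = t * \<Delta>"
      unfolding t cross2_def \<Delta>_def by (simp_all add: algebra_simps)
    then have px: "lp x > 0" "lq x > 0" using t \<Delta> by (simp_all add: lp_def lq_def)
    have "continuous_on UNIV lp" "continuous_on UNIV lq"
      unfolding lp_def lq_def cross2_def using \<Delta> by (auto intro!: continuous_intros)
    then have "open {y. 0 < lp y}" "open {y. 0 < lq y}"
      by (auto intro!: open_Collect_less continuous_on_const)
    then have "open ({y. 0 < lp y} \<inter> {y. 0 < lq y})" by blast
    then obtain \<epsilon> where \<epsilon>: "\<epsilon> > 0" "\<forall>y. dist y x < \<epsilon> \<longrightarrow> 0 < lp y \<and> 0 < lq y"
      using px by (fastforce simp: open_dist)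
    have "y \<in> tri K" if "dist y x < \<epsilon>" "\<nu> \<bullet> y < c" for y
    proof -
      have "0 < lp y" "0 < lq y" using \<epsilon> that by auto
      moreover have "cross2 (q - p) (y - p) / \<Delta> > 0" using nl[of y] that pos by simp
      ultimately show ?thesis
        unfolding tri using barycentric[of q p r y] \<Delta>
        unfolding \<Delta>_def lp_def lq_def by (smt (verit) mem_Collect_eq)
    qed
    then show ?thesis using \<epsilon>(1) by blast
  qed
  ultimately have "edge_normal K e \<nu> c" unfolding edge_normal_def by blast
  then show ?thesis using that by blast
qed

section \<open>Frontiers, outward normals and common edges\<close>

lemma edge_subset_frontier_tri:
  assumes "nondegenerate_triangle K" "e \<in> edges K"
  shows "e \<subseteq> frontier (tri K)"
proof -
  obtain \<nu> c where n: "edge_normal K e \<nu> c" using edge_normal_exists[OF assms] .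
  show ?thesis
    using n tri_convex_hull(1,4)[OF assms(1)]
    by (auto simp: edge_normal_def frontier_def interior_open)
qed

lemma tri_subset_edges:
  assumes "nondegenerate_triangle K" "x \<in> convex hull K" "x \<notin> tri K"
  obtains e where "e \<in> edges K" "x \<in> e"
proof -
  obtain p q r where K: "K = {p, q, r}" "p \<noteq> q" "q \<noteq> r" "p \<noteq> r"
    using assms(1) by (auto simp: nondegenerate_triangle_def card_3_iff)
  have "x \<in> frontier (convex hull K)"
    using assms(2,3) closure_subset by (auto simp: frontier_def tri_def)
  then have "x \<in> closed_segment p q \<union> closed_segment q r \<union> closed_segment r p"
    unfolding K(1) by (subst (asm) frontier_of_triangle) simp
  moreover have "closed_segment p q \<in> edges K" "closed_segment q r \<in> edges K" "closed_segment r p \<in> edges K"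
    using K unfolding edges_def by blast+
  ultimately show ?thesis using that by blast
qed

text \<open>If \<nu> + \<nu>' is nonzero, a small step from \<open>x\<close> against it decreases
  both linear functionals, because \<open>\<nu> \<bullet> \<nu>' > -1\<close>. The step then ends in
  both half discs, that is, in both triangles.\<close>

lemma disjoint_tri_opposite_normals:
  assumes "edge_normal K e \<nu> c" "edge_normal L e' \<nu>' c'" "tri K \<inter> tri L = {}"
    and x: "x \<in> rel_interior e" "x \<in> rel_interior e'"
  shows "\<nu>' = - \<nu>" "c' = - c"
proof -
  have xe: "x \<in> e" "x \<in> e'" using x rel_interior_subset by auto
  have c: "\<nu> \<bullet> x = c" "\<nu>' \<bullet> x = c'" and n: "norm \<nu> = 1" "norm \<nu>' = 1"
    using assms(1,2) xe unfolding edge_normal_def by auto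
  show "\<nu>' = - \<nu>"
  proof (rule ccontr)
    assume neq: "\<nu>' \<noteq> - \<nu>"
    have nn: "\<nu> \<bullet> \<nu> = 1" "\<nu>' \<bullet> \<nu>' = 1" using n by (simp_all add: norm_eq_1)
    have "0 < (\<nu> + \<nu>') \<bullet> (\<nu> + \<nu>')" using neq by (simp add: eq_neg_iff_add_eq_0 add.commute)
    then have g: "1 + \<nu> \<bullet> \<nu>' > 0" using nn by (simp add: inner_add_left inner_add_right inner_commute)
    obtain \<epsilon> where \<epsilon>: "\<epsilon> > 0" "\<forall>y. dist y x < \<epsilon> \<longrightarrow> \<nu> \<bullet> y < c \<longrightarrow> y \<in> tri K"
      using assms(1) x(1) unfolding edge_normal_def by blast
    obtain \<epsilon>' where \<epsilon>': "\<epsilon>' > 0" "\<forall>y. dist y x < \<epsilon>' \<longrightarrow> \<nu>' \<bullet> y < c' \<longrightarrow> y \<in> tri L"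
      using assms(2) x(2) unfolding edge_normal_def by blast
    \<comment> \<open>Since \<nu> + \<nu>' has norm at most 2, a quarter of the smaller radius moves
      the point by at most half of that radius.\<close>
    define s where "s = min \<epsilon> \<epsilon>' / 4"
    have s: "s > 0" using \<epsilon>(1) \<epsilon>'(1) by (simp add: s_def)
    define y where "y = x - s *\<^sub>R (\<nu> + \<nu>')"
    have "norm (\<nu> + \<nu>') \<le> 2" using norm_triangle_ineq[of \<nu> \<nu>'] n by simp
    then have "dist y x \<le> s * 2" using s by (simp add: y_def dist_norm)
    then have d: "dist y x < \<epsilon>" "dist y x < \<epsilon>'" using \<epsilon>(1) \<epsilon>'(1) s_def by auto
    have "\<nu> \<bullet> y = c - s * (1 + \<nu> \<bullet> \<nu>')" "\<nu>' \<bullet> y = c' - s * (1 + \<nu> \<bullet> \<nu>')"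
      unfolding y_def using c nn by (simp_all add: inner_diff_right inner_add_right inner_commute algebra_simps)
    then have "\<nu> \<bullet> y < c" "\<nu>' \<bullet> y < c'" using s g by simp_all
    then have "y \<in> tri K \<inter> tri L" using \<epsilon>(2) \<epsilon>'(2) d by blast
    then show False using assms(3) by blast
  qed
  then show "c' = - c" using c by auto
qed

lemma edge_rel_interior_ex:
  assumes "e \<in> edges K" obtains x where "x \<in> rel_interior e"
proof -
  have "rel_interior e \<noteq> {}"
    using assms by (auto simp: edges_def rel_interior_closed_segment)
  then show ?thesis using that by blast
qed

text \<open>This evaluates the definite description, so uniqueness is the point. For a second
  candidate \<nu>' the step from \<open>x\<close> along \<nu>' - \<nu> enters the half disc, hence
  the triangle, but increases the functional of \<nu>'.\<close>

lemma outward_normal_edge: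
  assumes "nondegenerate_triangle K" "e \<in> edges K" "edge_normal K e \<nu> c"
  shows "outward_normal (tri K) e = \<nu>"
  unfolding outward_normal_def
proof (rule the_equality)
  have on: "\<nu> \<bullet> x = c" if "x \<in> e" for x using assms(3) that by (auto simp: edge_normal_def)
  have n1: "norm \<nu> = 1" using assms(3) by (auto simp: edge_normal_def)
  show "norm \<nu> = 1 \<and> (\<forall>x\<in>e. \<forall>y\<in>tri K. \<nu> \<bullet> (y - x) \<le> 0)"
    using assms(3) on by (force simp: edge_normal_def inner_diff_right)
  fix \<nu>' assume \<nu>': "norm \<nu>' = 1 \<and> (\<forall>x\<in>e. \<forall>y\<in>tri K. \<nu>' \<bullet> (y - x) \<le> 0)"
  obtain x where x: "x \<in> rel_interior e" using edge_rel_interior_ex[OF assms(2)] .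
  then have xe: "x \<in> e" using rel_interior_subset by auto
  obtain \<epsilon> where \<epsilon>: "\<epsilon> > 0" "\<forall>y. dist y x < \<epsilon> \<longrightarrow> \<nu> \<bullet> y < c \<longrightarrow> y \<in> tri K"
    using assms(3) x unfolding edge_normal_def by blast
  show "\<nu>' = \<nu>"
  proof (rule ccontr)
    assume neq: "\<nu>' \<noteq> \<nu>"
    have nn: "\<nu> \<bullet> \<nu> = 1" "\<nu>' \<bullet> \<nu>' = 1" using n1 \<nu>' by (simp_all add: norm_eq_1)
    have "0 < (\<nu>' - \<nu>) \<bullet> (\<nu>' - \<nu>)" using neq by simp
    then have g: "1 - \<nu> \<bullet> \<nu>' > 0" using nn by (simp add: inner_diff_left inner_diff_right inner_commute)
    define y where "y = x + (\<epsilon> / 4) *\<^sub>R (\<nu>' - \<nu>)"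
    have "norm (\<nu>' - \<nu>) \<le> 2" using norm_triangle_ineq4[of \<nu>' \<nu>] n1 \<nu>' by simp
    then have "dist y x \<le> \<epsilon> / 4 * 2" using \<epsilon>(1) by (simp add: y_def dist_norm)
    then have d: "dist y x < \<epsilon>" using \<epsilon>(1) by linarith
    have "\<nu> \<bullet> y = c + \<epsilon> / 4 * (\<nu> \<bullet> \<nu>' - 1)"
      unfolding y_def using on[OF xe] nn by (simp add: inner_diff_right inner_add_right)
    moreover have "\<epsilon> / 4 * (\<nu> \<bullet> \<nu>' - 1) < 0" using \<epsilon>(1) g by (intro mult_pos_neg) auto
    ultimately have "y \<in> tri K" using \<epsilon>(2) d by simp
    then have "\<nu>' \<bullet> (y - x) \<le> 0" using \<nu>' xe by blast
    moreover have "\<nu>' \<bullet> (y - x) = \<epsilon> / 4 * (1 - \<nu> \<bullet> \<nu>')"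
      unfolding y_def using nn by (simp add: inner_diff_right inner_commute)
    moreover have "\<epsilon> / 4 * (1 - \<nu> \<bullet> \<nu>') > 0" using \<epsilon>(1) g by (intro mult_pos_pos) auto
    ultimately show False by linarith
  qed
qed

text \<open>In the affine parameter of the line through \<open>p\<close> and \<open>q\<close> the
  segments become real intervals with endpoints 0, 1 and \<open>s\<close>, \<open>t\<close>.
  Overlapping open intervals, neither of which contains an endpoint of the other, have the same
  endpoints, possibly in reverse order.\<close>

lemma closed_segment_eqI:
  fixes p q p' q' :: "'a::real_vector"
  assumes col: "p' - p = s *\<^sub>R (q - p)" "q' - p = t *\<^sub>R (q - p)"
    and x: "x \<in> open_segment p q" "x \<in> open_segment p' q'"
    and nin: "p \<notin> open_segment p' q'" "q \<notin> open_segment p' q'"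
      "p' \<notin> open_segment p q" "q' \<notin> open_segment p q"
  shows "closed_segment p' q' = closed_segment p q"
proof -
  have pq: "p \<noteq> q" "p' \<noteq> q'" using x by auto
  have p': "p' = (1 - s) *\<^sub>R p + s *\<^sub>R q" and q': "q' = (1 - t) *\<^sub>R p + t *\<^sub>R q"
    using col by (simp_all add: algebra_simps)
  define P where "P \<alpha> = (1 - \<alpha>) *\<^sub>R p + \<alpha> *\<^sub>R q" for \<alpha>
  have P: "P \<alpha> = p + \<alpha> *\<^sub>R (q - p)" for \<alpha> by (simp add: P_def algebra_simps)
  have Pinj: "P \<alpha> = P \<beta> \<longleftrightarrow> \<alpha> = \<beta>" for \<alpha> \<beta> using pq by (simp add: P)
  have Pv: "p = P 0" "q = P 1" "p' = P s" "q' = P t" using p' q' by (simp_all add: P_def)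
  have st: "s \<noteq> t" using pq(2) Pv by auto
  have os: "P \<alpha> \<in> open_segment p q \<longleftrightarrow> 0 < \<alpha> \<and> \<alpha> < 1" for \<alpha>
  proof -
    have "P \<alpha> \<in> open_segment p q \<longleftrightarrow> (\<exists>u. 0 < u \<and> u < 1 \<and> P \<alpha> = P u)"
      using pq unfolding in_segment P_def[symmetric] by auto
    then show ?thesis unfolding Pinj by auto
  qed
  have comb: "(1 - u) *\<^sub>R p' + u *\<^sub>R q' = P (s + u * (t - s))" for u
    unfolding p' q' P_def by (simp add: algebra_simps)
  have os': "P \<alpha> \<in> open_segment p' q' \<longleftrightarrow> min s t < \<alpha> \<and> \<alpha> < max s t" for \<alpha>
  proof -
    have "P \<alpha> \<in> open_segment p' q' \<longleftrightarrow> (\<exists>u. 0 < u \<and> u < 1 \<and> \<alpha> = s + u * (t - s))"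
      using pq unfolding in_segment comb Pinj by auto
    also have "\<dots> \<longleftrightarrow> \<alpha> \<in> open_segment s t"
      using st by (auto simp: in_segment algebra_simps)
    finally show ?thesis using st by (auto simp: open_segment_eq_real_ivl)
  qed
  obtain \<alpha> where \<alpha>: "x = P \<alpha>" using x(1) by (auto simp: in_segment P_def)
  have "0 < \<alpha>" "\<alpha> < 1" "min s t < \<alpha>" "\<alpha> < max s t"
    using x unfolding \<alpha> os os' by auto
  moreover have "\<not> (min s t < 0 \<and> 0 < max s t)" "\<not> (min s t < 1 \<and> 1 < max s t)"
    "\<not> (0 < s \<and> s < 1)" "\<not> (0 < t \<and> t < 1)"
    using nin os[of s] os[of t] os'[of 0] os'[of 1] unfolding Pv[symmetric] by blast+
  ultimately have "s = 0 \<and> t = 1 \<or> s = 1 \<and> t = 0" by (auto simp: min_def max_def split: if_splits)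
  then show ?thesis using Pv by (auto simp: closed_segment_commute)
qed

lemma common_edge_opposite_normals:
  assumes "tri K \<inter> tri L = {}" "e \<in> edges K" "edge_normal K e \<nu> c" "edge_normal L e \<nu>' c'"
  shows "\<nu>' = - \<nu>" "c' = - c"
  using disjoint_tri_opposite_normals[OF assms(3,4,1)] edge_rel_interior_ex[OF assms(2)] by metis+

text \<open>The closed triangles lie on opposite sides of the line through \<open>e\<close>. A
  common point thus lies on this line, which meets each of them exactly in \<open>e\<close>.\<close>

lemma frontier_Int_eq_common_edge:
  assumes K: "nondegenerate_triangle K" and L: "nondegenerate_triangle L" and disj: "tri K \<inter> tri L = {}"
    and e: "e \<in> edges K" "e \<in> edges L"
  shows "frontier (tri K) \<inter> frontier (tri L) = e"
proof
  obtain \<nu> c where n: "edge_normal K e \<nu> c" using edge_normal_exists[OF K e(1)] .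
  obtain \<nu>' c' where n': "edge_normal L e \<nu>' c'" using edge_normal_exists[OF L e(2)] .
  have opp: "\<nu>' = - \<nu>" "c' = - c" using common_edge_opposite_normals[OF disj e(1) n n'] by auto
  show "e \<subseteq> frontier (tri K) \<inter> frontier (tri L)"
    using edge_subset_frontier_tri K L e by blast
  show "frontier (tri K) \<inter> frontier (tri L) \<subseteq> e"
  proof
    fix x assume "x \<in> frontier (tri K) \<inter> frontier (tri L)"
    then have x: "x \<in> convex hull K" "x \<in> convex hull L"
      using tri_convex_hull(4) K L unfolding frontier_def by auto
    then have "\<nu> \<bullet> x \<le> c" "\<nu>' \<bullet> x \<le> c'" using n n' unfolding edge_normal_def by auto
    then have "\<nu> \<bullet> x = c" by (simp add: opp)
    then show "x \<in> e" using n x unfolding edge_normal_def by blast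
  qed
qed

lemma common_edge_outward_normal:
  assumes K: "nondegenerate_triangle K" and L: "nondegenerate_triangle L" and disj: "tri K \<inter> tri L = {}"
    and e: "e \<in> edges K" "e \<in> edges L"
  shows "outward_normal (tri L) e = - outward_normal (tri K) e"
proof -
  obtain \<nu> c where n: "edge_normal K e \<nu> c" using edge_normal_exists[OF K e(1)] .
  obtain \<nu>' c' where n': "edge_normal L e \<nu>' c'" using edge_normal_exists[OF L e(2)] .
  show ?thesis
    using common_edge_opposite_normals[OF disj e(1) n n'] outward_normal_edge[OF K e(1) n]
      outward_normal_edge[OF L e(2) n'] by simp
qed

text \<open>Three pairwise disjoint triangles on one edge would have pairwise opposite normals,
  which forces \<nu> = -\<nu> for a unit vector.\<close>

lemma common_edge_unique_nbr:
  assumes "nondegenerate_triangle K" "nondegenerate_triangle L" "nondegenerate_triangle M"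
    and "tri K \<inter> tri L = {}" "tri K \<inter> tri M = {}" "e \<in> edges K" "e \<in> edges L" "e \<in> edges M"
  shows "tri L \<inter> tri M \<noteq> {}"
proof
  assume LM: "tri L \<inter> tri M = {}"
  obtain \<nu> c where n: "edge_normal K e \<nu> c" using edge_normal_exists assms by meson
  obtain \<nu>' c' where n': "edge_normal L e \<nu>' c'" using edge_normal_exists assms by meson
  obtain \<nu>'' c'' where n'': "edge_normal M e \<nu>'' c''" using edge_normal_exists assms by meson
  have "\<nu>' = - \<nu>" "\<nu>'' = - \<nu>" "\<nu>'' = - \<nu>'"
    using common_edge_opposite_normals n n' n'' assms LM by metis+
  then have "\<nu> = 0" by (simp add: eq_neg_iff_add_eq_0 flip: scaleR_2)
  then show False using n by (simp add: edge_normal_def)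
qed

text \<open>The orthogonal complement of a nonzero vector in the plane is a line. The two displayed
  identities are the elimination of \<nu> from the orthogonality relations.\<close>

lemma cross2_eq_0_if_orthogonal:
  assumes "\<nu> \<noteq> 0" "\<nu> \<bullet> v = 0" "\<nu> \<bullet> w = 0"
  shows "cross2 v w = 0"
proof -
  have o: "\<nu> $ 1 * v $ 1 + \<nu> $ 2 * v $ 2 = 0" "\<nu> $ 1 * w $ 1 + \<nu> $ 2 * w $ 2 = 0"
    using assms(2,3) by (simp_all add: inner_vec_def sum_2)
  have "\<nu> $ 1 * cross2 v w = (\<nu> $ 1 * v $ 1 + \<nu> $ 2 * v $ 2) * w $ 2 - (\<nu> $ 1 * w $ 1 + \<nu> $ 2 * w $ 2) * v $ 2"
    "\<nu> $ 2 * cross2 v w = (\<nu> $ 1 * w $ 1 + \<nu> $ 2 * w $ 2) * v $ 1 - (\<nu> $ 1 * v $ 1 + \<nu> $ 2 * v $ 2) * w $ 1"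
    by (simp_all add: cross2_def algebra_simps)
  then have "\<nu> $ 1 * cross2 v w = 0" "\<nu> $ 2 * cross2 v w = 0" by (simp_all add: o)
  then show ?thesis using assms(1) by (auto simp: vec_eq_iff forall_2)
qed

section \<open>Interior edges of conforming triangulations\<close>

lemma conforming_triangulationD:
  assumes "conforming_triangulation S \<K>"
  shows "finite \<K>" "L \<in> \<K> \<Longrightarrow> nondegenerate_triangle L" "closure S = (\<Union>K\<in>\<K>. convex hull K)"
    "L \<in> \<K> \<Longrightarrow> M \<in> \<K> \<Longrightarrow> L \<noteq> M \<Longrightarrow> tri L \<inter> tri M = {}"
    "L \<in> \<K> \<Longrightarrow> M \<in> \<K> \<Longrightarrow> L \<noteq> M \<Longrightarrow> p \<in> L \<Longrightarrow> e \<in> edges M \<Longrightarrow> p \<notin> rel_interior e"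
proof -
  show "finite \<K>" "L \<in> \<K> \<Longrightarrow> nondegenerate_triangle L" "closure S = (\<Union>K\<in>\<K>. convex hull K)"
    "L \<in> \<K> \<Longrightarrow> M \<in> \<K> \<Longrightarrow> L \<noteq> M \<Longrightarrow> tri L \<inter> tri M = {}"
    using assms by (simp_all add: conforming_triangulation_def triangle_partition_def)
  show "p \<notin> rel_interior e" if "L \<in> \<K>" "M \<in> \<K>" "L \<noteq> M" "p \<in> L" "e \<in> edges M"
  proof -
    have "M \<in> \<K> - {L}" using that by simp
    then show ?thesis using assms that(1,4,5) unfolding conforming_triangulation_def by simp
  qed
qed

text \<open>Crossing \<open>e\<close> outwards at a point \<open>x\<close> of \<Omega> leads out of
  \<open>K\<close> but not out of \<Omega>, so by closedness another closed triangle contains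
  \<open>x\<close>. Its edge through \<open>x\<close> lies on the line of \<open>e\<close> by
  opposite normals, and conformity identifies the two segments.\<close>

lemma interior_edge_shared:
  assumes \<Omega>: "open \<Omega>" and conf: "conforming_triangulation \<Omega> \<K>" and K: "K \<in> \<K>" and e: "e \<in> edges K"
    and nfr: "\<not> e \<subseteq> frontier \<Omega>"
  shows "\<exists>L\<in>\<K> - {K}. e \<in> edges L"
proof -
  note fin = conforming_triangulationD(1)[OF conf] and nd = conforming_triangulationD(2)[OF conf]
    and cl = conforming_triangulationD(3)[OF conf] and disj = conforming_triangulationD(4)[OF conf]
    and vert = conforming_triangulationD(5)[OF conf]
  obtain p q where pq: "e = closed_segment p q" "p \<in> K" "q \<in> K" "p \<noteq> q"
    using e by (auto simp: edges_def)
  have rie: "rel_interior e = open_segment p q" using pq by (simp add: rel_interior_closed_segment)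
  \<comment> \<open>The frontier is closed, so if it contained the open segment it would contain all
    of \<open>e\<close>. Hence \<open>x\<close> can be chosen away from the endpoints, where the
    half disc property is available.\<close>
  have "\<not> open_segment p q \<subseteq> frontier \<Omega>"
  proof
    assume "open_segment p q \<subseteq> frontier \<Omega>"
    then have "closure (open_segment p q) \<subseteq> frontier \<Omega>"
      by (rule closure_minimal) (rule frontier_closed)
    then show False using nfr pq by (simp add: closure_open_segment)
  qed
  then obtain x where x: "x \<in> open_segment p q" "x \<notin> frontier \<Omega>" by blast
  then have xe: "x \<in> e" "x \<in> rel_interior e" using pq rie by (auto simp: open_segment_def)
  obtain \<nu> c where n: "edge_normal K e \<nu> c" using edge_normal_exists[OF nd[OF K] e] .
  have \<nu>x: "\<nu> \<bullet> x = c" "x \<in> convex hull K" using n xe unfolding edge_normal_def by auto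
  then have "x \<in> closure \<Omega>" using cl K by blast
  then have x\<Omega>: "x \<in> \<Omega>" using x(2) \<Omega> by (simp add: frontier_def interior_open)
  have "x \<in> (\<Union>L\<in>\<K> - {K}. convex hull L)"
  proof (rule ccontr)
    assume nx: "x \<notin> (\<Union>L\<in>\<K> - {K}. convex hull L)"
    have "closed (convex hull L)" if "L \<in> \<K>" for L
      using tri_convex_hull(4)[OF nd[OF that]] closed_closure by metis
    then have "closed (\<Union>L\<in>\<K> - {K}. convex hull L)" using fin by blast
    then have "open (\<Omega> - (\<Union>L\<in>\<K> - {K}. convex hull L))" using \<Omega> by blast
    then obtain \<epsilon> where \<epsilon>: "\<epsilon> > 0" "\<forall>y. dist y x < \<epsilon> \<longrightarrow> y \<in> \<Omega> - (\<Union>L\<in>\<K> - {K}. convex hull L)"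
      using nx x\<Omega> unfolding open_dist by blast
    \<comment> \<open>Half the radius in the outward direction: \<open>y\<close> remains in \<Omega>
      and off the other triangles, yet violates the half plane bound of \<open>K\<close>.\<close>
    define y where "y = x + (\<epsilon> / 2) *\<^sub>R \<nu>"
    have n1: "norm \<nu> = 1" using n by (simp add: edge_normal_def)
    have "dist y x < \<epsilon>" using \<epsilon>(1) n1 by (simp add: y_def dist_norm)
    then have y: "y \<in> \<Omega>" "y \<notin> (\<Union>L\<in>\<K> - {K}. convex hull L)" using \<epsilon>(2) by auto
    then have "y \<in> convex hull K" using cl closure_subset by blast
    then have "\<nu> \<bullet> y \<le> c" using n by (simp add: edge_normal_def)
    moreover have "\<nu> \<bullet> y = c + \<epsilon> / 2" using \<nu>x n1 by (simp add: y_def inner_add_right norm_eq_1)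
    ultimately show False using \<epsilon>(1) by simp
  qed
  then obtain L where L: "L \<in> \<K>" "L \<noteq> K" "x \<in> convex hull L" by blast
  have KL: "tri K \<inter> tri L = {}" using disj[OF K L(1)] L(2) by auto
  \<comment> \<open>The open set \<open>tri L\<close> is disjoint from \<open>tri K\<close>, hence
    also from its closure, which contains \<open>x\<close>.\<close>
  have "x \<notin> tri L"
    using KL open_Int_closure_eq_empty[of "tri L" "tri K"] tri_convex_hull(1)[OF nd[OF L(1)]]
      tri_convex_hull(4)[OF nd[OF K]] \<nu>x(2) by auto
  then obtain e' where e': "e' \<in> edges L" "x \<in> e'" using tri_subset_edges[OF nd[OF L(1)] L(3)] by blast
  obtain p' q' where pq': "e' = closed_segment p' q'" "p' \<in> L" "q' \<in> L" "p' \<noteq> q'"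
    using e' by (auto simp: edges_def)
  have rie': "rel_interior e' = open_segment p' q'" using pq' by (simp add: rel_interior_closed_segment)
  have v: "p' \<notin> open_segment p q" "q' \<notin> open_segment p q" "p \<notin> open_segment p' q'" "q \<notin> open_segment p' q'"
    using vert[OF L(1) K L(2) pq'(2) e] vert[OF L(1) K L(2) pq'(3) e]
      vert[OF K L(1) L(2)[symmetric] pq(2) e'(1)] vert[OF K L(1) L(2)[symmetric] pq(3) e'(1)]
    unfolding rie rie' by simp_all
  \<comment> \<open>If \<open>x\<close> were an endpoint of \<open>e'\<close>, a vertex of
    \<open>L\<close> would lie inside the edge \<open>e\<close> of \<open>K\<close>.\<close>
  then have x': "x \<in> open_segment p' q'" using x e' pq' by (auto simp: open_segment_def)
  obtain \<nu>' c' where n': "edge_normal L e' \<nu>' c'" using edge_normal_exists[OF nd[OF L(1)] e'(1)] .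
  have opp: "\<nu>' = - \<nu>" "c' = - c"
    using disjoint_tri_opposite_normals[OF n n' KL xe(2)] x' rie' by auto
  have line: "\<exists>s. y - p = s *\<^sub>R (q - p)" if "y \<in> e'" for y
  proof -
    have "\<nu> \<bullet> y = c" using n' that opp unfolding edge_normal_def by auto
    moreover have "\<nu> \<bullet> p = c" "\<nu> \<bullet> q = c" using n pq unfolding edge_normal_def by auto
    ultimately have o: "\<nu> \<bullet> (q - p) = 0" "\<nu> \<bullet> (y - p) = 0" by (simp_all add: inner_diff_right)
    have "\<nu> \<noteq> 0" using n by (auto simp: edge_normal_def)
    then have "cross2 (q - p) (y - p) = 0" using o by (rule cross2_eq_0_if_orthogonal)
    then show ?thesis using pq(4) unfolding cross2_eq_0_iff by (auto intro: exI[of _ 0])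
  qed
  have "p' \<in> e'" "q' \<in> e'" using pq' by auto
  then obtain s t where "p' - p = s *\<^sub>R (q - p)" "q' - p = t *\<^sub>R (q - p)"
    using line[of p'] line[of q'] by blast
  then have "e' = e"
    unfolding pq(1) pq'(1) by (rule closed_segment_eqI) (use x x' v in auto)
  then show ?thesis using L e' by blast
qed

section \<open>Square integrable functions on edges\<close>

text \<open>The endpoints picked by \<open>SOME\<close> need not be \<open>p\<close> and
  \<open>q\<close>; only the fact that they span \<open>e\<close> is used. If they coincide,
  division by zero gives 0 and the parametrization stays in \<open>e\<close>.\<close>

lemma arclength_closed_segment:
  assumes "e = closed_segment p q"
  shows "space (arclength e) = e" "sets (arclength e) = sets (restrict_space borel e)"
    "finite_measure (arclength e)"
proof -
  define pq where "pq = (SOME pq. e = closed_segment (fst pq) (snd pq))"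
  obtain P Q where PQ: "pq = (P, Q)" by fastforce
  have "e = closed_segment (fst pq) (snd pq)"
    unfolding pq_def by (rule someI[of _ "(p, q)"]) (simp add: assms)
  then have e: "e = closed_segment P Q" by (simp add: PQ)
  define M where "M = restrict_space lborel {0..dist P Q}"
  define g where "g s = P + (s / dist P Q) *\<^sub>R (Q - P)" for s
  have arc: "arclength e = distr M (restrict_space borel e) g"
    unfolding arclength_def pq_def[symmetric] PQ M_def g_def by simp
  show "space (arclength e) = e" "sets (arclength e) = sets (restrict_space borel e)"
    by (simp_all add: arc space_restrict_space)
  have "g s \<in> e" if "s \<in> {0..dist P Q}" for s
    unfolding e in_segment g_def using that
    by (intro exI[of _ "s / dist P Q"]) (auto simp: algebra_simps divide_le_eq_1)
  moreover have "g \<in> borel_measurable borel"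
    unfolding g_def divide_inverse by (intro borel_measurable_continuous_onI continuous_intros)
  ultimately have g: "g \<in> measurable M (restrict_space borel e)"
    unfolding M_def by (intro measurable_restrict_space2 measurable_restrict_space1) auto
  have fin: "finite_measure M"
    unfolding M_def by (intro finite_measureI) (simp add: emeasure_restrict_space)
  show "finite_measure (arclength e)"
    unfolding arc by (rule finite_measure.finite_measure_distr[OF fin g])
qed

lemma arclength_edge:
  assumes "e \<in> edges K"
  shows "space (arclength e) = e" "sets (arclength e) = sets (restrict_space borel e)"
    "finite_measure (arclength e)"
proof -
  obtain p q where e: "e = closed_segment p q" using assms by (auto simp: edges_def)
  show "space (arclength e) = e" "sets (arclength e) = sets (restrict_space borel e)"
    "finite_measure (arclength e)"
    by (rule arclength_closed_segment[OF e])+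
qed

lemma L2_bounded:
  assumes "finite_measure M" "f \<in> borel_measurable M" "AE x in M. norm (f x) \<le> B"
  shows "L2 M f"
  unfolding L2_def
proof
  show "f \<in> borel_measurable M" by fact
  have "AE x in M. norm ((norm (f x))\<^sup>2) \<le> B\<^sup>2"
    using assms(3) by eventually_elim (simp add: power_mono)
  then show "integrable M (\<lambda>x. (norm (f x))\<^sup>2)"
    using assms(2) by (intro finite_measure.integrable_const_bound[OF assms(1)]) auto
qed

lemma L2_inner_integrable:
  assumes "L2 M f" "L2 M g"
  shows "integrable M (\<lambda>x. f x \<bullet> g x)"
proof (rule Bochner_Integration.integrable_bound)
  show "integrable M (\<lambda>x. (norm (f x))\<^sup>2 + (norm (g x))\<^sup>2)"
    using assms by (auto simp: L2_def)
  show "(\<lambda>x. f x \<bullet> g x) \<in> borel_measurable M"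
    using assms by (auto simp: L2_def)
  have "\<bar>f x \<bullet> g x\<bar> \<le> (norm (f x))\<^sup>2 + (norm (g x))\<^sup>2" for x
  proof -
    have "\<bar>f x \<bullet> g x\<bar> \<le> norm (f x) * norm (g x)" by (rule Cauchy_Schwarz_ineq2)
    moreover have "2 * norm (f x) * norm (g x) \<le> (norm (f x))\<^sup>2 + (norm (g x))\<^sup>2"
      by (rule sum_squares_bound)
    moreover have "0 \<le> norm (f x) * norm (g x)" by simp
    ultimately show ?thesis by (simp add: mult.assoc)
  qed
  then show "AE x in M. norm (f x \<bullet> g x) \<le> norm ((norm (f x))\<^sup>2 + (norm (g x))\<^sup>2)" by simp
qed

lemma L2_mult_integrable:
  fixes f g :: "'a \<Rightarrow> real"
  assumes "L2 M f" "L2 M g"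
  shows "integrable M (\<lambda>x. f x * g x)"
  using L2_inner_integrable[OF assms] by simp

lemma L2_arclength_continuous:
  assumes "e \<in> edges K" "continuous_on e f"
  shows "L2 (arclength e) f"
proof -
  have "compact e" using assms(1) by (auto simp: edges_def)
  then have "bounded (f ` e)" using compact_continuous_image[OF assms(2)] by (simp add: compact_imp_bounded)
  then obtain B where B: "\<forall>x\<in>e. norm (f x) \<le> B" by (auto simp: bounded_iff)
  show ?thesis
  proof (rule L2_bounded)
    show "finite_measure (arclength e)" by (rule arclength_edge(3)[OF assms(1)])
    have "f \<in> borel_measurable (restrict_space borel e)"
      by (rule borel_measurable_continuous_on_restrict[OF assms(2)])
    then show "f \<in> borel_measurable (arclength e)"
      by (simp add: measurable_cong_sets[OF arclength_edge(2)[OF assms(1)] refl])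
    show "AE x in arclength e. norm (f x) \<le> B"
      using B by (intro AE_I2) (simp add: arclength_edge(1)[OF assms(1)])
  qed
qed

lemma L2_tendsto_const: "L2 M f \<Longrightarrow> L2_tendsto M (\<lambda>_. f) f"
  by (simp add: L2_tendsto_def)

section \<open>Piecewise affine functions are weakly differentiable\<close>

text \<open>Along the segment from \<open>x\<close> to \<open>y\<close>, which stays in
  \<open>T\<close> by convexity, the preimages of the pieces form a finite closed cover of the unit
  interval. On each of them \<open>v\<close> is Lipschitz with the same constant, and such bounds
  glue along an interval.\<close>

lemma piecewise_affine_lipschitz:
  fixes v :: "'a::euclidean_space \<Rightarrow> real"
  assumes "convex T" "finite \<P>" "\<And>P. P \<in> \<P> \<Longrightarrow> closed P" "T \<subseteq> \<Union>\<P>"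
    and aff: "\<And>P x. P \<in> \<P> \<Longrightarrow> x \<in> P \<Longrightarrow> v x = b P \<bullet> x + c P"
    and B: "\<And>P. P \<in> \<P> \<Longrightarrow> norm (b P) \<le> B" "B \<ge> 0"
    and xy: "x \<in> T" "y \<in> T"
  shows "\<bar>v x - v y\<bar> \<le> B * dist x y"
proof -
  define l where "l t = x + t *\<^sub>R (y - x)" for t
  have l: "l t \<in> T" if "t \<in> {0..1}" for t
  proof -
    have "l t = (1 - t) *\<^sub>R x + t *\<^sub>R y" by (simp add: l_def algebra_simps)
    then show ?thesis using that xy assms(1) by (simp add: convex_alt)
  qed
  have "(B * dist x y)-lipschitz_on {0..1} (v \<circ> l)"
  proof (rule lipschitz_on_closed_Union)
    fix P assume P: "P \<in> \<P>"
    show "(B * dist x y)-lipschitz_on (l -` P) (v \<circ> l)"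
    proof (rule lipschitz_onI)
      fix s t assume st: "s \<in> l -` P" "t \<in> l -` P"
      have "v (l s) - v (l t) = b P \<bullet> ((s - t) *\<^sub>R (y - x))"
        using aff[OF P] st by (simp add: l_def algebra_simps)
      then have "\<bar>v (l s) - v (l t)\<bar> \<le> norm (b P) * norm ((s - t) *\<^sub>R (y - x))"
        by (simp only: Cauchy_Schwarz_ineq2)
      also have "\<dots> \<le> B * norm ((s - t) *\<^sub>R (y - x))"
        using B(1)[OF P] by (rule mult_right_mono) simp
      finally show "dist ((v \<circ> l) s) ((v \<circ> l) t) \<le> B * dist x y * dist s t"
        by (simp add: dist_norm norm_minus_commute mult_ac)
    qed (use B(2) in simp)
    show "closed (l -` P)"
      using assms(3)[OF P] unfolding l_def by (intro closed_vimage continuous_intros)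
  next
    show "{0..1} \<subseteq> (\<Union>P\<in>\<P>. l -` P)" using l assms(4) by blast
  qed (use assms(2) B(2) in auto)
  then have "dist ((v \<circ> l) 0) ((v \<circ> l) 1) \<le> B * dist x y * dist (0::real) 1"
    by (rule lipschitz_onD) auto
  then show ?thesis by (simp add: l_def dist_norm)
qed

lemma lborel_integral_shift:
  fixes f :: "'a::euclidean_space \<Rightarrow> real"
  assumes [measurable]: "f \<in> borel_measurable borel"
  shows "(\<integral>x. f (x + a) \<partial>lborel) = (\<integral>x. f x \<partial>lborel)"
    and "integrable lborel (\<lambda>x. f (x + a)) \<longleftrightarrow> integrable lborel f"
proof -
  have d: "distr lborel borel ((+) a) = (lborel :: 'a measure)" by (rule lborel_distr_plus)
  show "(\<integral>x. f (x + a) \<partial>lborel) = (\<integral>x. f x \<partial>lborel)"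
    by (subst (2) d[symmetric], subst integral_distr) (simp_all add: add.commute)
  show "integrable lborel (\<lambda>x. f (x + a)) \<longleftrightarrow> integrable lborel f"
    by (subst (2) d[symmetric], subst integrable_distr_eq) (simp_all add: add.commute)
qed

lemma grad_affine:
  assumes "open S" "x \<in> S" "\<And>y. y \<in> S \<Longrightarrow> v y = b \<bullet> y + c"
  shows "grad v x = b"
proof -
  have "((\<lambda>y. b \<bullet> y + c) has_derivative (\<lambda>h. b \<bullet> h)) (at x)"
    by (auto intro!: derivative_eq_intros)
  then have "(v has_derivative (\<lambda>h. b \<bullet> h)) (at x)"
    by (rule has_derivative_transform_within_open[OF _ assms(1,2)]) (simp add: assms(3))
  then have "frechet_derivative v (at x) = (\<lambda>h. b \<bullet> h)" by (rule frechet_derivative_at[symmetric])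
  then show ?thesis
    by (simp add: grad_def partial_def vec_eq_iff inner_axis)
qed

text \<open>Off its closed support a test function vanishes in a neighbourhood, so its partial
  derivatives vanish there as well; the bounds then come from compactness of the support.\<close>

lemma test_fun_bounds:
  assumes "test_fun S \<phi>"
  shows "(\<phi> has_derivative frechet_derivative \<phi> (at x)) (at x)"
    and "continuous_on UNIV \<phi>" "continuous_on UNIV (partial j \<phi>)"
    and "x \<notin> S \<Longrightarrow> \<phi> x = 0" "x \<notin> S \<Longrightarrow> partial j \<phi> x = 0"
    and "\<exists>M. \<forall>x. \<bar>\<phi> x\<bar> \<le> M" "\<exists>M. \<forall>x. \<bar>partial j \<phi> x\<bar> \<le> M"
proof -
  define C where "C = closure {x. \<phi> x \<noteq> 0}"
  have C: "compact C" "C \<subseteq> S" using assms by (auto simp: test_fun_def C_def)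
  have d: "\<phi> differentiable (at x)" "partial j \<phi> differentiable (at x)" for x
  proof -
    \<comment> \<open>The lists \<open>[]\<close> and \<open>[j]\<close> extract differentiability
      of the function itself and of one partial derivative.\<close>
    have "foldr partial [] \<phi> differentiable (at x)" "foldr partial [j] \<phi> differentiable (at x)"
      using assms unfolding test_fun_def by blast+
    then show "\<phi> differentiable (at x)" "partial j \<phi> differentiable (at x)" by simp_all
  qed
  show "(\<phi> has_derivative frechet_derivative \<phi> (at x)) (at x)"
    using d(1) by (simp add: frechet_derivative_works)
  show c: "continuous_on UNIV \<phi>" "continuous_on UNIV (partial j \<phi>)"
    using d by (auto intro!: continuous_at_imp_continuous_on differentiable_imp_continuous_within)
  have z: "\<phi> x = 0" if "x \<notin> C" for x
    using that closure_subset[of "{x. \<phi> x \<noteq> 0}"] by (auto simp: C_def)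
  have z': "partial j \<phi> x = 0" if "x \<notin> C" for x
  proof -
    have "open (- C)" by (simp add: C_def open_Compl)
    then have "grad \<phi> x = 0" by (rule grad_affine[where c = 0]) (use that z in auto)
    then show ?thesis by (simp add: grad_def vec_eq_iff)
  qed
  show "x \<notin> S \<Longrightarrow> \<phi> x = 0" "x \<notin> S \<Longrightarrow> partial j \<phi> x = 0" using z z' C by blast+
  have bd: "\<exists>M. \<forall>x. \<bar>f x\<bar> \<le> M" if "continuous_on UNIV f" "\<And>x. x \<notin> C \<Longrightarrow> f x = 0" for f :: "real^2 \<Rightarrow> real"
  proof -
    have "bounded (f ` C)"
      by (intro compact_imp_bounded compact_continuous_image continuous_on_subset[OF that(1)] C(1)) simp
    then obtain M where M: "\<forall>x\<in>C. \<bar>f x\<bar> \<le> M" by (auto simp: bounded_iff)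
    have "\<bar>f x\<bar> \<le> max M 0" for x using M that(2)[of x] by (cases "x \<in> C") auto
    then show ?thesis by blast
  qed
  show "\<exists>M. \<forall>x. \<bar>\<phi> x\<bar> \<le> M" "\<exists>M. \<forall>x. \<bar>partial j \<phi> x\<bar> \<le> M" using bd[OF c(1) z] bd[OF c(2) z'] by auto
qed

lemma partial_difference_quotient:
  assumes "\<And>x. (\<phi> has_derivative frechet_derivative \<phi> (at x)) (at x)"
  shows "((\<lambda>t. \<phi> (x + t *\<^sub>R axis j 1)) has_real_derivative partial j \<phi> (x + t *\<^sub>R axis j 1)) (at t)"
proof -
  let ?f' = "frechet_derivative \<phi> (at (x + t *\<^sub>R axis j 1))"
  have lin: "linear ?f'" by (rule has_derivative_linear[OF assms])
  have "((\<lambda>t. \<phi> (x + t *\<^sub>R axis j 1)) has_derivative (\<lambda>s. ?f' (s *\<^sub>R axis j 1))) (at t)"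
    by (rule has_derivative_compose[OF _ assms]) (auto intro!: derivative_eq_intros)
  moreover have "(\<lambda>s. ?f' (s *\<^sub>R axis j 1)) = (*) (partial j \<phi> (x + t *\<^sub>R axis j 1))"
    using linear_cmul[OF lin] by (auto simp: partial_def fun_eq_iff)
  ultimately show ?thesis by (simp add: has_field_derivative_def)
qed

text \<open>The difference quotients of the test function converge boundedly to its derivative; shifting them to
  \<open>v\<close>, which is Lipschitz continuous, they converge boundedly to the a.e. gradient of \<open>v\<close>.\<close>

lemma piecewise_affine_H1_grad:
  fixes v :: "real^2 \<Rightarrow> real"
  assumes T: "open T" "convex T" "bounded T" and \<P>: "finite \<P>" "\<And>P. P \<in> \<P> \<Longrightarrow> closed P"
    "\<And>P. P \<in> \<P> \<Longrightarrow> convex P" "T \<subseteq> \<Union>\<P>"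
    and aff: "\<And>P. P \<in> \<P> \<Longrightarrow> \<exists>b c. \<forall>x\<in>P. v x = b \<bullet> x + c"
  shows "H1_grad T v (grad v)"
proof -
  obtain b c where bc: "\<And>P x. P \<in> \<P> \<Longrightarrow> x \<in> P \<Longrightarrow> v x = b P \<bullet> x + c P"
    using aff by metis
  \<comment> \<open>The sum of all slopes serves as a common bound for the finitely many
    pieces.\<close>
  define B where "B = (\<Sum>P\<in>\<P>. norm (b P))"
  have B: "norm (b P) \<le> B" if "P \<in> \<P>" for P
    unfolding B_def by (rule member_le_sum) (use that \<P>(1) in auto)
  have B0: "B \<ge> 0" by (simp add: B_def sum_nonneg)
  have lip: "\<bar>v x - v y\<bar> \<le> B * dist x y" if "x \<in> T" "y \<in> T" for x y
    by (rule piecewise_affine_lipschitz[OF T(2) \<P>(1,2,4) bc B B0 that])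
  obtain C where C: "\<And>x. x \<in> T \<Longrightarrow> \<bar>v x\<bar> \<le> C" "C \<ge> 0"
  proof -
    obtain R where R: "\<forall>x\<in>T. norm x \<le> R" using T(3) by (auto simp: bounded_iff)
    have "\<bar>v x\<bar> \<le> B * \<bar>R\<bar> + (\<Sum>P\<in>\<P>. \<bar>c P\<bar>)" if x: "x \<in> T" for x
    proof -
      obtain P where P: "P \<in> \<P>" "x \<in> P" using x \<P>(4) by blast
      have "\<bar>b P \<bullet> x\<bar> \<le> norm (b P) * norm x" by (rule Cauchy_Schwarz_ineq2)
      also have "\<dots> \<le> B * \<bar>R\<bar>" using B[OF P(1)] R x by (intro mult_mono B0) fastforce+
      finally have "\<bar>b P \<bullet> x\<bar> \<le> B * \<bar>R\<bar>" .
      moreover have "\<bar>c P\<bar> \<le> (\<Sum>P\<in>\<P>. \<bar>c P\<bar>)"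
        by (rule member_le_sum) (use P \<P>(1) in auto)
      ultimately show ?thesis using bc[OF P] by linarith
    qed
    moreover have "B * \<bar>R\<bar> + (\<Sum>P\<in>\<P>. \<bar>c P\<bar>) \<ge> 0" using B0 by (simp add: sum_nonneg)
    ultimately show ?thesis using that by blast
  qed
  \<comment> \<open>Frontiers of convex sets are null sets, and off them every point of
    \<open>T\<close> is interior to some piece.\<close>
  define N where "N = (\<Union>P\<in>\<P>. frontier P)"
  have N: "closed N" "negligible N"
    unfolding N_def using \<P> negligible_convex_frontier by (auto intro!: closed_UN negligible_Union)
  have piece: "\<exists>P\<in>\<P>. x \<in> interior P" if "x \<in> T - N" for x
    using that \<P>(2,4) by (fastforce simp: N_def frontier_def)
  have grad: "grad v x = b P" if "P \<in> \<P>" "x \<in> interior P" for x P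
    by (rule grad_affine[OF open_interior that(2)]) (use bc[OF that(1)] interior_subset in blast)
  have TN: "open (T - N)" using T(1) N(1) by blast
  have cont_v: "continuous_on T v"
    by (rule lipschitz_on_continuous_on[of B]) (use lip B0 in \<open>auto intro!: lipschitz_onI simp: dist_real_def\<close>)
  have cont_grad: "continuous_on (T - N) (grad v)"
  proof (rule continuous_at_imp_continuous_on, intro ballI)
    fix x assume "x \<in> T - N"
    then obtain P where P: "P \<in> \<P>" "x \<in> interior P" using piece by blast
    then have "\<forall>\<^sub>F y in nhds x. grad v y = b P"
      using eventually_nhds_in_open[OF open_interior P(2)] grad[OF P(1)] by (auto elim: eventually_mono)
    then show "isCont (grad v) x" by (simp add: isCont_cong)
  qed
  have T_meas: "T \<in> sets borel" "T \<in> sets lebesgue" using T(1) by auto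
  have T_fin: "T \<in> lmeasurable" using T(1,3) by (simp add: lmeasurable_open)
  have fm: "finite_measure (lebesgue_on T)" using T_fin by (rule finite_measure_lebesgue_on)
  have AE_N: "AE x in lebesgue. x \<notin> N"
    unfolding eventually_ae_filter_negligible using N(2) by (intro exI[of _ N]) auto
  \<comment> \<open>Extension by zero allows translations on the whole plane. The Lipschitz bound
    for \<open>v\<close> is available only when both points lie in \<open>T\<close>, which the
    support of the test function will ensure.\<close>
  define V where "V x = indicator T x *\<^sub>R v x" for x
  have V_meas [measurable]: "V \<in> borel_measurable borel"
    unfolding V_def by (rule borel_measurable_continuous_on_indicator[OF T_meas(1) cont_v])
  have V_bd: "\<bar>V x\<bar> \<le> C" for x using C by (simp add: V_def indicator_def)
  have v_meas: "v \<in> borel_measurable (lebesgue_on T)"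
    using V_meas T_meas by (simp add: borel_measurable_restrict_space_iff V_def[abs_def] measurable_completion)
  \<comment> \<open>The values of \<open>grad v\<close> on \<open>N\<close> are uncontrolled, so
    measurability is obtained only for the completed measure. This is why the limit below is taken
    over \<open>lebesgue\<close> although the translation is done over
    \<open>lborel\<close>.\<close>
  have ind_grad: "(\<lambda>x. indicator T x *\<^sub>R grad v x) \<in> borel_measurable lebesgue"
  proof (rule borel_measurable_AE)
    have "(\<lambda>x. indicator (T - N) x *\<^sub>R grad v x) \<in> borel_measurable borel"
      by (rule borel_measurable_continuous_on_indicator[OF _ cont_grad]) (use TN in auto)
    then show "(\<lambda>x. indicator (T - N) x *\<^sub>R grad v x) \<in> borel_measurable lebesgue"
      by (simp add: measurable_completion)
    show "AE x in lebesgue. indicator (T - N) x *\<^sub>R grad v x = indicator T x *\<^sub>R grad v x"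
      using AE_N by eventually_elim (simp add: indicator_def)
  qed
  then have grad_meas: "grad v \<in> borel_measurable (lebesgue_on T)"
    using T_meas by (simp add: borel_measurable_restrict_space_iff)
  have L2v: "L2 (lebesgue_on T) v"
    by (rule L2_bounded[OF fm v_meas, of C]) (use C in \<open>auto intro!: AE_I2\<close>)
  have L2g: "L2 (lebesgue_on T) (grad v)"
  proof (rule L2_bounded[OF fm grad_meas, of B])
    have "AE x in lebesgue. x \<in> T \<longrightarrow> norm (grad v x) \<le> B"
      using AE_N
    proof eventually_elim
      case (elim x)
      show ?case
      proof
        assume "x \<in> T"
        then obtain P where "P \<in> \<P>" "x \<in> interior P" using piece elim by blast
        then show "norm (grad v x) \<le> B" using grad B by simp
      qed
    qed
    then show "AE x in lebesgue_on T. norm (grad v x) \<le> B"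
      using T_meas by (simp add: AE_restrict_space_iff)
  qed
  have ibp: "(\<integral>x. v x * partial j \<phi> x \<partial>lebesgue_on T) = - (\<integral>x. grad v x $ j * \<phi> x \<partial>lebesgue_on T)"
    if \<phi>: "test_fun T \<phi>" for \<phi> j
  proof -
    define e :: "real^2" where "e = axis j 1"
    have ne: "norm e = 1" by (simp add: e_def)
    define h where "h k = 1 / real (Suc k)" for k
    have h: "h k > 0" for k by (simp add: h_def)
    have h0: "h \<longlonglongrightarrow> 0" unfolding h_def by (rule LIMSEQ_Suc[OF lim_1_over_n])
    note \<phi>_der = test_fun_bounds(1)[OF \<phi>]
    obtain M where M: "\<And>x. \<bar>\<phi> x\<bar> \<le> M" using test_fun_bounds(6)[OF \<phi>] by blast
    obtain M' where M': "\<And>x. \<bar>partial j \<phi> x\<bar> \<le> M'" using test_fun_bounds(7)[OF \<phi>] by blast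
    have [measurable]: "\<phi> \<in> borel_measurable borel" "partial j \<phi> \<in> borel_measurable borel"
      using test_fun_bounds(2,3)[OF \<phi>] by (auto intro: borel_measurable_continuous_onI)
    have iT: "integrable lborel (\<lambda>x. a * indicator T x :: real)" for a
      using T_fin T_meas by (auto simp: fmeasurable_def intro!: integrable_real_indicator)
    have iTl: "integrable lebesgue (\<lambda>x. a * indicator T x :: real)" for a
      using T_fin by (auto simp: fmeasurable_def intro!: integrable_real_indicator)
    define Dq where "Dq k x = (\<phi> (x + h k *\<^sub>R e) - \<phi> x) / h k" for k x
    \<comment> \<open>This is the difference quotient after the substitution of
      \<open>x - h k *\<^sub>R e\<close> for \<open>x\<close>. The backward shift is the source of
      the minus sign in integration by parts.\<close>
    define E where "E k x = (V (x - h k *\<^sub>R e) - V x) / h k * \<phi> x" for k x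
    have Dq_lim: "(\<lambda>k. Dq k x) \<longlonglongrightarrow> partial j \<phi> x" for x
    proof -
      have "((\<lambda>t. \<phi> (x + t *\<^sub>R e)) has_real_derivative partial j \<phi> x) (at 0)"
        using partial_difference_quotient[OF \<phi>_der, of x j 0] by (simp add: e_def)
      then have "((\<lambda>t. (\<phi> (x + t *\<^sub>R e) - \<phi> x) / t) \<longlongrightarrow> partial j \<phi> x) (at 0)"
        by (simp add: has_field_derivative_iff)
      moreover have "filterlim h (at 0) sequentially"
        using h0 h by (auto simp: filterlim_at less_imp_neq[symmetric])
      ultimately show ?thesis unfolding Dq_def by (rule filterlim_compose)
    qed
    have Dq_bd: "\<bar>Dq k x\<bar> \<le> M'" for k x
    proof -
      \<comment> \<open>The mean value theorem turns the bound on the partial derivative into a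
        bound on the quotients that is uniform in \<open>k\<close> and \<open>x\<close>.\<close>
      have "\<exists>z>0. z < h k \<and> \<phi> (x + h k *\<^sub>R e) - \<phi> (x + 0 *\<^sub>R e) = (h k - 0) * partial j \<phi> (x + z *\<^sub>R e)"
        using partial_difference_quotient[OF \<phi>_der, of x j] h[of k]
        by (intro MVT2) (auto simp: e_def)
      then obtain z where "\<phi> (x + h k *\<^sub>R e) - \<phi> x = h k * partial j \<phi> (x + z *\<^sub>R e)" by auto
      then have "Dq k x = partial j \<phi> (x + z *\<^sub>R e)" using h[of k] by (simp add: Dq_def)
      then show ?thesis using M' by simp
    qed
    have lim1: "(\<lambda>k. \<integral>x. V x * Dq k x \<partial>lborel) \<longlonglongrightarrow> (\<integral>x. V x * partial j \<phi> x \<partial>lborel)"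
    proof (rule integral_dominated_convergence[OF _ _ iT[of "C * M'"]])
      show "(\<lambda>x. V x * Dq k x) \<in> borel_measurable lborel" for k
        unfolding Dq_def by measurable
      show "AE x in lborel. (\<lambda>k. V x * Dq k x) \<longlonglongrightarrow> V x * partial j \<phi> x"
        by (intro AE_I2 tendsto_mult_left Dq_lim)
      have "\<bar>V x\<bar> * \<bar>Dq k x\<bar> \<le> C * M' * indicator T x" for k x
        using mult_mono[OF V_bd[of x] Dq_bd[of k x] C(2)] by (cases "x \<in> T") (auto simp: V_def abs_mult)
      then show "AE x in lborel. norm (V x * Dq k x) \<le> C * M' * indicator T x" for k
        by (intro AE_I2) (simp add: abs_mult)
    qed measurable
    have shift: "(\<integral>x. V x * Dq k x \<partial>lborel) = (\<integral>x. E k x \<partial>lborel)" for k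
    proof -
      have bound: "integrable lborel (\<lambda>x. V x * \<phi> (x + w))" for w
      proof (rule Bochner_Integration.integrable_bound[OF iT[of "C * M"]])
        have "M \<ge> 0" using M[of 0] by simp
        then have "\<bar>V x\<bar> * \<bar>\<phi> (x + w)\<bar> \<le> \<bar>C * M * indicator T x\<bar>" for x
          using C(2) mult_mono[OF V_bd[of x] M[of "x + w"] C(2)] by (cases "x \<in> T") (auto simp: V_def abs_mult)
        then show "AE x in lborel. norm (V x * \<phi> (x + w)) \<le> norm (C * M * indicator T x)"
          by (intro AE_I2) (simp add: abs_mult)
      qed measurable
      let ?w = "h k *\<^sub>R e"
      have m: "(\<lambda>x. V (x - ?w) * \<phi> x) \<in> borel_measurable borel" by measurable
      have s: "(\<integral>x. V x * \<phi> (x + ?w) \<partial>lborel) = (\<integral>x. V (x - ?w) * \<phi> x \<partial>lborel)"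
        "integrable lborel (\<lambda>x. V (x - ?w) * \<phi> x)"
        using lborel_integral_shift[OF m, of ?w] bound[of ?w] by simp_all
      have b0: "integrable lborel (\<lambda>x. V x * \<phi> x)" using bound[of 0] by simp
      have "(\<integral>x. V x * Dq k x \<partial>lborel) = (\<integral>x. (1 / h k) * (V x * \<phi> (x + ?w) - V x * \<phi> x) \<partial>lborel)"
        by (simp add: Dq_def right_diff_distrib diff_divide_distrib)
      also have "\<dots> = (1 / h k) * ((\<integral>x. V x * \<phi> (x + ?w) \<partial>lborel) - (\<integral>x. V x * \<phi> x \<partial>lborel))"
        using bound[of ?w] b0 by simp
      also have "\<dots> = (\<integral>x. (1 / h k) * (V (x - ?w) * \<phi> x - V x * \<phi> x) \<partial>lborel)"
        using s b0 by simp
      also have "\<dots> = (\<integral>x. E k x \<partial>lborel)"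
        by (simp add: E_def left_diff_distrib diff_divide_distrib)
      finally show ?thesis .
    qed
    have supp: "compact (closure {x. \<phi> x \<noteq> 0})" "closure {x. \<phi> x \<noteq> 0} \<subseteq> T"
      using \<phi> by (auto simp: test_fun_def)
    \<comment> \<open>The support has a positive margin inside \<open>T\<close>; shifts shorter than
      \<epsilon> keep its points in \<open>T\<close>.\<close>
    obtain \<epsilon> where \<epsilon>: "\<epsilon> > 0" "(\<Union>x\<in>closure {x. \<phi> x \<noteq> 0}. ball x \<epsilon>) \<subseteq> T"
      using compact_subset_open_imp_ball_epsilon_subset[OF supp(1) T(1) supp(2)] .
    obtain k0 where k0: "\<And>k. k \<ge> k0 \<Longrightarrow> h k < \<epsilon>"
      using order_tendstoD(2)[OF h0 \<epsilon>(1)] unfolding eventually_sequentially by blast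
    have E_bd: "\<bar>E k x\<bar> \<le> B * M * indicator T x" if "k \<ge> k0" for k x
    proof (cases "\<phi> x = 0")
      case True
      have "M \<ge> 0" using M[of x] by simp
      then show ?thesis using True B0 by (simp add: E_def)
    next
      case False
      then have cl: "x \<in> closure {x. \<phi> x \<noteq> 0}" using closure_subset[of "{x. \<phi> x \<noteq> 0}"] by auto
      have d: "dist (x - h k *\<^sub>R e) x = h k" using ne h[of k] by (simp add: dist_norm)
      then have "x - h k *\<^sub>R e \<in> ball x \<epsilon>" using k0[OF that] by (simp add: dist_commute)
      then have "x - h k *\<^sub>R e \<in> T" by (intro subsetD[OF \<epsilon>(2)] UN_I[OF cl])
      moreover have "x \<in> T" using supp(2) cl by (rule subsetD)
      ultimately have in_T: "x - h k *\<^sub>R e \<in> T" "x \<in> T" by simp_all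
      have "\<bar>V (x - h k *\<^sub>R e) - V x\<bar> \<le> B * h k"
        using lip[OF in_T] in_T d by (simp add: V_def)
      then have "\<bar>V (x - h k *\<^sub>R e) - V x\<bar> / h k \<le> B" using h[of k] by (simp add: pos_divide_le_eq)
      then have "\<bar>V (x - h k *\<^sub>R e) - V x\<bar> / h k * \<bar>\<phi> x\<bar> \<le> B * M" by (intro mult_mono M B0) auto
      then show ?thesis using h[of k] in_T by (simp add: E_def abs_mult)
    qed
    have m_lim: "(\<lambda>x. - ((indicator T x *\<^sub>R grad v x) $ j * \<phi> x)) \<in> borel_measurable lebesgue"
    proof -
      have "(\<lambda>x. (indicator T x *\<^sub>R grad v x) \<bullet> axis j 1) \<in> borel_measurable lebesgue"
        by (intro borel_measurable_inner ind_grad) simp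
      then have "(\<lambda>x. (indicator T x *\<^sub>R grad v x) $ j) \<in> borel_measurable lebesgue"
        by (simp add: inner_axis)
      moreover have "\<phi> \<in> borel_measurable lebesgue" by (simp add: measurable_completion)
      ultimately show ?thesis by simp
    qed
    have E_meas: "E k \<in> borel_measurable borel" for k unfolding E_def by measurable
    have lim2: "(\<lambda>k. \<integral>x. E (k + k0) x \<partial>lebesgue) \<longlonglongrightarrow>
        (\<integral>x. - ((indicator T x *\<^sub>R grad v x) $ j * \<phi> x) \<partial>lebesgue)"
    \<comment> \<open>The domination \<open>E_bd\<close> holds only from \<open>k0\<close> on, hence
      the shifted sequence.\<close>
    proof (rule integral_dominated_convergence[OF m_lim _ iTl[of "B * M"]])
      show "E (k + k0) \<in> borel_measurable lebesgue" for k
        using E_meas by (simp add: measurable_completion)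
      show "AE x in lebesgue. norm (E (k + k0) x) \<le> B * M * indicator T x" for k
        using E_bd[of "k + k0"] by (intro AE_I2) simp
      show "AE x in lebesgue. (\<lambda>k. E (k + k0) x) \<longlonglongrightarrow> - ((indicator T x *\<^sub>R grad v x) $ j * \<phi> x)"
        using AE_N
      proof eventually_elim
        case (elim x)
        show ?case
        proof (cases "x \<in> T")
          case False
          then show ?thesis using test_fun_bounds(4)[OF \<phi>] by (simp add: E_def)
        next
          case True
          then obtain P where P: "P \<in> \<P>" "x \<in> interior P" using piece elim by blast
          have "(\<lambda>k. x - h k *\<^sub>R e) \<longlonglongrightarrow> x - 0 *\<^sub>R e" by (intro tendsto_intros h0)
          moreover have "open (T \<inter> interior P)" using T(1) by blast
          ultimately have "\<forall>\<^sub>F k in sequentially. x - h k *\<^sub>R e \<in> T \<inter> interior P"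
            using True P by (intro topological_tendstoD) auto
          \<comment> \<open>Once the shifted point lies in the same affine piece, the quotient
            equals its limit exactly.\<close>
          then have "\<forall>\<^sub>F k in sequentially. E k x = - (grad v x $ j * \<phi> x)"
          proof eventually_elim
            case (elim k)
            have "v (x - h k *\<^sub>R e) - v x = - (h k * (b P \<bullet> e))"
              using bc[OF P(1)] elim P(2) interior_subset[of P] by (simp add: inner_diff_right subset_iff)
            then show ?case
              using elim True h[of k] grad[OF P] by (simp add: E_def V_def e_def inner_axis)
          qed
          then have "(\<lambda>k. E k x) \<longlonglongrightarrow> - (grad v x $ j * \<phi> x)" by (rule tendsto_eventually)
          then show ?thesis using True by (intro LIMSEQ_ignore_initial_segment) simp
        qed
      qed
    qed
    have "(\<lambda>k. \<integral>x. E (k + k0) x \<partial>lebesgue) \<longlonglongrightarrow> (\<integral>x. V x * partial j \<phi> x \<partial>lborel)"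
      using LIMSEQ_ignore_initial_segment[OF lim1, of k0] E_meas by (simp add: shift integral_completion)
    then have eq: "(\<integral>x. V x * partial j \<phi> x \<partial>lborel) = (\<integral>x. - ((indicator T x *\<^sub>R grad v x) $ j * \<phi> x) \<partial>lebesgue)"
      using lim2 LIMSEQ_unique by blast
    have "(\<integral>x. v x * partial j \<phi> x \<partial>lebesgue_on T) = (\<integral>x. V x * partial j \<phi> x \<partial>lebesgue)"
      using T_meas by (simp add: integral_restrict_space V_def mult.assoc)
    also have "\<dots> = (\<integral>x. V x * partial j \<phi> x \<partial>lborel)"
      by (rule integral_completion) measurable
    also note eq
    also have "(\<integral>x. - ((indicator T x *\<^sub>R grad v x) $ j * \<phi> x) \<partial>lebesgue)
        = - (\<integral>x. grad v x $ j * \<phi> x \<partial>lebesgue_on T)"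
      using T_meas by (simp add: integral_restrict_space mult.assoc)
    finally show ?thesis .
  qed
  show ?thesis unfolding H1_grad_def using L2v L2g ibp by blast
qed

section \<open>Subdomains and interfaces\<close>

text \<open>The mesh triangles inside \<open>K\<close> cover \<open>tri K\<close>: a mesh triangle
  through a point of \<open>tri K\<close> lies in some closed subdomain \<open>K'\<close>, and since
  \<open>tri K\<close> is open and meets the closure of \<open>tri K'\<close>, it meets
  \<open>tri K'\<close> itself, so \<open>K' = K\<close>.\<close>

lemma Vh_H1_grad:
  assumes conf: "conforming_triangulation S \<K>" "conforming_triangulation S \<T>" "mesh_refines \<T> \<K>"
    and K: "K \<in> \<K>" and v: "v \<in> Vh S \<T> K"
  shows "H1_grad (tri K) v (grad v)"
proof -
  note ndK = conforming_triangulationD(2)[OF conf(1)] and ndT = conforming_triangulationD(2)[OF conf(2)]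
  note tri = tri_convex_hull[OF ndK[OF K]]
  define \<P> where "\<P> = {convex hull L | L. L \<in> \<T> \<and> convex hull L \<subseteq> closure (tri K)}"
  have "\<P> \<subseteq> (hull) convex ` \<T>" by (auto simp: \<P>_def)
  then have fin: "finite \<P>" by (rule finite_subset) (use conforming_triangulationD(1)[OF conf(2)] in simp)
  have cover: "tri K \<subseteq> \<Union>\<P>"
  proof
    fix x assume x: "x \<in> tri K"
    then have "x \<in> closure S" using conforming_triangulationD(3)[OF conf(1)] K tri(3) by auto
    then obtain L where L: "L \<in> \<T>" "x \<in> convex hull L" using conforming_triangulationD(3)[OF conf(2)] by auto
    obtain K' where K': "K' \<in> \<K>" "convex hull L \<subseteq> convex hull K'"
      using conf(3) L(1) unfolding mesh_refines_def by auto
    have "x \<in> closure (tri K')" using L(2) K'(2) tri_convex_hull(4)[OF ndK[OF K'(1)]] by auto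
    then have "tri K \<inter> tri K' \<noteq> {}"
      using x open_Int_closure_eq_empty[OF tri(1), of "tri K'"] by auto
    then have "K' = K" using conforming_triangulationD(4)[OF conf(1) K K'(1)] by auto
    then show "x \<in> \<Union>\<P>" using L K'(2) tri(4) by (auto simp: \<P>_def)
  qed
  show ?thesis
  proof (rule piecewise_affine_H1_grad[OF tri(1,2) _ fin _ _ cover])
    have "bounded (convex hull K)"
      using ndK[OF K] by (intro bounded_convex_hull finite_imp_bounded) (simp add: nondegenerate_triangle_def card_ge_0_finite)
    then show "bounded (tri K)" using tri(3) bounded_subset by auto
    fix P assume "P \<in> \<P>"
    then obtain L where L: "P = convex hull L" "L \<in> \<T>" "convex hull L \<subseteq> closure (tri K)" by (auto simp: \<P>_def)
    show "closed P" "convex P" unfolding L(1) using tri_convex_hull(4)[OF ndT[OF L(2)]] closed_closure[of "tri L"] by simp_all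
    show "\<exists>b c. \<forall>x\<in>P. v x = b \<bullet> x + c" using v L by (simp add: Vh_def)
  qed
qed

text \<open>The constant sequence \<open>v\<close> is an admissible approximation; on the compact
  edges continuity gives square integrability.\<close>

lemma H1_has_trace:
  assumes K: "nondegenerate_triangle K" and v: "H1_grad (tri K) v g" "continuous_on (closure (tri K)) v"
  shows "has_trace K v v"
  unfolding has_trace_def
proof (intro exI conjI allI ballI)
  show "H1_grad (tri K) v g" "H1_grad (tri K) v g" "continuous_on (closure (tri K)) v" using v by simp_all
  show "L2_tendsto (lebesgue_on (tri K)) (\<lambda>_. v) v" "L2_tendsto (lebesgue_on (tri K)) (\<lambda>_. g) g"
    using v(1) by (auto simp: H1_grad_def intro: L2_tendsto_const)
  fix e assume e: "e \<in> edges K"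
  have "e \<subseteq> closure (tri K)" using edge_subset_frontier_tri[OF K e] by (auto simp: frontier_def)
  then show "L2_tendsto (arclength e) (\<lambda>_. v) v"
    by (intro L2_tendsto_const L2_arclength_continuous[OF e] continuous_on_subset[OF v(2)])
qed

section \<open>Edges of a subdomain indexed by its neighbours\<close>

lemma nbrs_sym: "d \<in> {1..D} \<Longrightarrow> d' \<in> nbrs D K d \<Longrightarrow> d \<in> nbrs D K d'"
  unfolding nbrs_def by auto

lemma iface_commute: "iface K d d' = iface K d' d"
  by (simp add: iface_def Int_commute)

lemma conforming_indexedD:
  fixes K :: "nat \<Rightarrow> (real^2) set"
  assumes "conforming_triangulation S (K ` {1..D})" "inj_on K {1..D}" "d \<in> {1..D}"
  shows "nondegenerate_triangle (K d)"
    and "d' \<in> {1..D} \<Longrightarrow> d \<noteq> d' \<Longrightarrow> tri (K d) \<inter> tri (K d') = {}"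
proof -
  show "nondegenerate_triangle (K d)"
    by (rule conforming_triangulationD(2)[OF assms(1)]) (use assms(3) in simp)
  assume d': "d' \<in> {1..D}" "d \<noteq> d'"
  then have "K d \<noteq> K d'" using assms(2,3) by (auto dest: inj_onD)
  then show "tri (K d) \<inter> tri (K d') = {}"
    using conforming_triangulationD(4)[OF assms(1)] assms(3) d'(1) by simp
qed

lemma nbr_iface:
  assumes conf: "conforming_triangulation S (K ` {1..D})" "inj_on K {1..D}"
    and d: "d \<in> {1..D}" and d': "d' \<in> nbrs D K d"
  shows "d' \<in> {1..D}" "d' \<noteq> d" "iface K d d' \<in> edges (K d)" "iface K d d' \<in> edges (K d')"
    and "outward_normal (tri (K d')) (iface K d' d) = - outward_normal (tri (K d)) (iface K d d')"
proof -
  show d'': "d' \<in> {1..D}" "d' \<noteq> d" using d' by (auto simp: nbrs_def)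
  obtain e where e: "e \<in> edges (K d)" "e \<in> edges (K d')" using d' by (auto simp: nbrs_def)
  have "iface K d d' = e"
    unfolding iface_def using conforming_indexedD[OF conf] d d'' e
    by (intro frontier_Int_eq_common_edge) auto
  then show "iface K d d' \<in> edges (K d)" "iface K d d' \<in> edges (K d')"
    "outward_normal (tri (K d')) (iface K d' d) = - outward_normal (tri (K d)) (iface K d d')"
    using e common_edge_outward_normal[of "K d" "K d'" e] conforming_indexedD[OF conf] d d''
    by (simp_all add: iface_commute[of K d'])
qed

text \<open>Reindexing along \<open>iface K d\<close>, which is injective because an edge has only
  one triangle on its other side. An edge that is not an interface lies on the boundary, where
  \<open>g\<close> contributes nothing.\<close>

lemma sum_edges_eq_sum_nbrs:
  fixes g :: "(real^2) set \<Rightarrow> 'a::comm_monoid_add"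
  assumes S: "open S" and conf: "conforming_triangulation S (K ` {1..D})" "inj_on K {1..D}"
    and d: "d \<in> {1..D}" and g: "\<And>e. e \<in> edges (K d) \<Longrightarrow> e \<subseteq> frontier S \<Longrightarrow> g e = 0"
  shows "(\<Sum>e\<in>edges (K d). g e) = (\<Sum>d'\<in>nbrs D K d. g (iface K d d'))"
proof -
  have nd: "nondegenerate_triangle (K d)" using conforming_indexedD[OF conf d] by simp
  have "inj_on (iface K d) (nbrs D K d)"
  proof (rule inj_onI, rule ccontr)
    fix d1 d2 assume *: "d1 \<in> nbrs D K d" "d2 \<in> nbrs D K d" "iface K d d1 = iface K d d2" "d1 \<noteq> d2"
    note n1 = nbr_iface[OF conf d *(1)] and n2 = nbr_iface[OF conf d *(2)]
    have "tri (K d1) \<inter> tri (K d2) \<noteq> {}"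
      by (rule common_edge_unique_nbr[OF nd])
        (use conforming_indexedD[OF conf] d n1 n2 *(3) in auto)
    then show False using conforming_indexedD(2)[OF conf] n1(1) n2(1) *(4) by simp
  qed
  then have "(\<Sum>d'\<in>nbrs D K d. g (iface K d d')) = (\<Sum>e\<in>iface K d ` nbrs D K d. g e)"
    by (simp add: sum.reindex)
  also have "\<dots> = (\<Sum>e\<in>edges (K d). g e)"
  proof (rule sum.mono_neutral_left)
    have "finite (K d)" using nd by (simp add: nondegenerate_triangle_def card_ge_0_finite)
    then have "finite ((\<lambda>(p, q). closed_segment p q) ` (K d \<times> K d))" by simp
    then show "finite (edges (K d))" by (rule rev_finite_subset) (auto simp: edges_def)
    show "iface K d ` nbrs D K d \<subseteq> edges (K d)" using nbr_iface(3)[OF conf d] by auto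
    show "\<forall>e\<in>edges (K d) - iface K d ` nbrs D K d. g e = 0"
    proof
      fix e assume e: "e \<in> edges (K d) - iface K d ` nbrs D K d"
      have "e \<subseteq> frontier S"
      proof (rule ccontr)
        assume "\<not> e \<subseteq> frontier S"
        then have "\<exists>L\<in>K ` {1..D} - {K d}. e \<in> edges L"
          by (intro interior_edge_shared[OF S conf(1)]) (use d e in auto)
        then obtain d' where d': "d' \<in> {1..D}" "K d' \<noteq> K d" "e \<in> edges (K d')" by blast
        then have nb: "d' \<in> nbrs D K d" using e by (auto simp: nbrs_def)
        have "iface K d d' = e"
          unfolding iface_def using conforming_indexedD[OF conf] d d' e
          by (intro frontier_Int_eq_common_edge) auto
        then show False using e nb by auto
      qed
      then show "g e = 0" using g e by simp
    qed
  qed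
  finally show ?thesis by simp
qed

section \<open>Localisation of domain integrals to subdomains\<close>

lemma glue_tri:
  assumes conf: "conforming_triangulation S (K ` {1..D})" "inj_on K {1..D}"
    and "d \<in> {1..D}" "y \<in> tri (K d)"
  shows "glue D K g y = g d y"
proof -
  have "(THE d. d \<in> {1..D} \<and> y \<in> tri (K d)) = d"
    using conforming_indexedD(2)[OF conf] assms(3,4) by (intro the_equality) auto
  then show ?thesis using assms(3,4) unfolding glue_def by auto
qed

text \<open>Up to the frontiers of finitely many triangles, a null set, the indicators of the open
  triangles add up to the indicator of \<open>S\<close>.\<close>

lemma lebesgue_on_triangle_partition:
  fixes h :: "real^2 \<Rightarrow> real" and K :: "nat \<Rightarrow> (real^2) set"
  assumes S: "convex_polygonal_domain S"
    and conf: "conforming_triangulation S (K ` {1..D})" "inj_on K {1..D}"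
  shows "integrable (lebesgue_on S) h \<longleftrightarrow> (\<forall>d\<in>{1..D}. integrable (lebesgue_on (tri (K d))) h)"
    and "integrable (lebesgue_on S) h \<Longrightarrow>
      (\<integral>y. h y \<partial>lebesgue_on S) = (\<Sum>d = 1..D. \<integral>y. h y \<partial>lebesgue_on (tri (K d)))"
proof -
  have S': "open S" "convex S" using S by (auto simp: convex_polygonal_domain_def)
  note nd = conforming_indexedD(1)[OF conf]
  have meas: "S \<in> sets lebesgue" "\<And>d. d \<in> {1..D} \<Longrightarrow> tri (K d) \<in> sets lebesgue"
    using S'(1) tri_convex_hull(1)[OF nd] by auto
  have cl: "closure S = (\<Union>d\<in>{1..D}. convex hull (K d))"
    using conforming_triangulationD(3)[OF conf(1)] by simp
  have sub: "tri (K d) \<subseteq> S" if "d \<in> {1..D}" for d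
  proof -
    have "tri (K d) \<subseteq> interior (closure S)"
      unfolding tri_def cl using that by (intro interior_mono) auto
    \<comment> \<open>An open convex set is the interior of its closure, so the triangles lie in
      \<open>S\<close> and not merely in its closure.\<close>
    also have "\<dots> = S" using S' by (simp add: convex_interior_closure interior_open)
    finally show ?thesis .
  qed
  define N where "N = (\<Union>d\<in>{1..D}. frontier (convex hull (K d)))"
  have "negligible N"
    unfolding N_def by (intro negligible_Union) (auto intro: negligible_convex_frontier)
  then have "AE x in lebesgue. x \<notin> N"
    unfolding eventually_ae_filter_negligible by (intro exI[of _ N]) auto
  then have ae: "AE x in lebesgue. (\<Sum>d = 1..D. indicator (tri (K d)) x *\<^sub>R h x) = indicator S x *\<^sub>R h x"
  proof eventually_elim
    case (elim x)
    show ?case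
    proof (cases "x \<in> S")
      case True
      then have "x \<in> closure S" using closure_subset by auto
      then obtain d where d: "d \<in> {1..D}" "x \<in> convex hull (K d)" using cl by auto
      then have x: "x \<in> tri (K d)"
        using elim closure_subset[of "convex hull (K d)"] by (auto simp: N_def frontier_def tri_def)
      have "(\<Sum>d' = 1..D. indicator (tri (K d')) x *\<^sub>R h x) = (\<Sum>d' \<in> {1..D}. if d' = d then h x else 0)"
        using conforming_indexedD(2)[OF conf d(1)] x by (intro sum.cong) (auto simp: indicator_def)
      then show ?thesis using True d(1) by simp
    next
      case False
      then have "x \<notin> tri (K d)" if "d \<in> {1..D}" for d using sub[OF that] by auto
      then have "(\<Sum>d = 1..D. indicator (tri (K d)) x *\<^sub>R h x) = 0" by (intro sum.neutral) simp
      then show ?thesis using False by simp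
    qed
  qed
  have restr: "integrable (lebesgue_on S) h \<longleftrightarrow> integrable lebesgue (\<lambda>x. indicator S x *\<^sub>R h x)"
    "\<And>d. d \<in> {1..D} \<Longrightarrow> integrable (lebesgue_on (tri (K d))) h \<longleftrightarrow> integrable lebesgue (\<lambda>x. indicator (tri (K d)) x *\<^sub>R h x)"
    using meas by (simp_all add: integrable_restrict_space)
  show iff: "integrable (lebesgue_on S) h \<longleftrightarrow> (\<forall>d\<in>{1..D}. integrable (lebesgue_on (tri (K d))) h)"
  proof
    assume i: "integrable (lebesgue_on S) h"
    show "\<forall>d\<in>{1..D}. integrable (lebesgue_on (tri (K d))) h"
    proof
      fix d assume d: "d \<in> {1..D}"
      have "integrable lebesgue (\<lambda>x. indicator (tri (K d)) x *\<^sub>R indicator S x *\<^sub>R h x)"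
        using i unfolding restr(1) by (rule integrable_mult_indicator[OF meas(2)[OF d]])
      moreover have "(\<lambda>x. indicator (tri (K d)) x *\<^sub>R indicator S x *\<^sub>R h x) = (\<lambda>x. indicator (tri (K d)) x *\<^sub>R h x)"
        using sub[OF d] by (fastforce simp: indicator_def fun_eq_iff)
      ultimately show "integrable (lebesgue_on (tri (K d))) h" using restr(2)[OF d] by simp
    qed
  next
    assume i: "\<forall>d\<in>{1..D}. integrable (lebesgue_on (tri (K d))) h"
    then have "integrable lebesgue (\<lambda>x. \<Sum>d = 1..D. indicator (tri (K d)) x *\<^sub>R h x)"
      using restr(2) by (intro Bochner_Integration.integrable_sum) simp
    then have "integrable lebesgue (\<lambda>x. indicator S x *\<^sub>R h x)"
      using borel_measurable_AE[OF borel_measurable_integrable ae] ae by (metis (no_types) integrable_cong_AE_imp)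
    then show "integrable (lebesgue_on S) h" using restr(1) by simp
  qed
  show "(\<integral>y. h y \<partial>lebesgue_on S) = (\<Sum>d = 1..D. \<integral>y. h y \<partial>lebesgue_on (tri (K d)))"
    if i: "integrable (lebesgue_on S) h"
  proof -
    have id: "integrable lebesgue (\<lambda>x. indicator (tri (K d)) x *\<^sub>R h x)" if "d \<in> {1..D}" for d
      using i iff restr(2) that by simp
    have "(\<integral>y. h y \<partial>lebesgue_on S) = (\<integral>x. indicator S x *\<^sub>R h x \<partial>lebesgue)"
      using meas by (simp add: integral_restrict_space)
    also have "\<dots> = (\<integral>x. (\<Sum>d = 1..D. indicator (tri (K d)) x *\<^sub>R h x) \<partial>lebesgue)"
    proof (rule integral_cong_AE)
      show "AE x in lebesgue. indicator S x *\<^sub>R h x = (\<Sum>d = 1..D. indicator (tri (K d)) x *\<^sub>R h x)"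
        using ae by eventually_elim (rule sym)
      show "(\<lambda>x. indicator S x *\<^sub>R h x) \<in> borel_measurable lebesgue" using i restr(1) by simp
      show "(\<lambda>x. \<Sum>d = 1..D. indicator (tri (K d)) x *\<^sub>R h x) \<in> borel_measurable lebesgue"
        using id by (intro borel_measurable_integrable Bochner_Integration.integrable_sum) simp
    qed
    also have "\<dots> = (\<Sum>d = 1..D. \<integral>x. indicator (tri (K d)) x *\<^sub>R h x \<partial>lebesgue)"
      using id by (intro Bochner_Integration.integral_sum) simp
    also have "\<dots> = (\<Sum>d = 1..D. \<integral>y. h y \<partial>lebesgue_on (tri (K d)))"
      using meas by (intro sum.cong) (simp_all add: integral_restrict_space)
    finally show ?thesis .
  qed
qed

section \<open>Transformed coefficients\<close>

lemma transpose_transformed_matrix: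
  assumes "transpose (a (inv \<phi> y)) = a (inv \<phi> y)"
  shows "transpose (transformed_matrix J \<phi> a y) = transformed_matrix J \<phi> a y"
  unfolding transformed_matrix_def
  by (simp add: transpose_scalar matrix_transpose_mul assms matrix_mul_assoc scalar_mult_eq_scaleR[symmetric])

text \<open>The point is to evaluate the coefficient only where its symmetry is known. For
  \<open>inv \<phi>\<close> to be meaningful \<phi> must be injective: its image contains three
  noncollinear points, which makes the linear part surjective and hence injective in finite
  dimension.\<close>

lemma inv_affine_tri:
  fixes J :: "real^2^2"
  assumes K: "nondegenerate_triangle K" and \<phi>: "\<And>x. \<phi> x = J *v x + c" and vert: "\<And>p. p \<in> K \<Longrightarrow> \<phi> (g p) = p"
    and y: "y \<in> tri K"
  shows "inv \<phi> y \<in> interior (convex hull (g ` K))"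
proof -
  have lin: "linear ((*v) J)" by simp
  obtain p q r where "K = {p, q, r}" "p \<noteq> q" "p \<noteq> r" "q \<noteq> r"
    using K by (auto simp: nondegenerate_triangle_def card_3_iff)
  then have pqr: "p \<in> K" "q \<in> K" "r \<in> K" "\<not> collinear {p, q, r}"
    using K by (auto simp: nondegenerate_triangle_def collinear_3_eq_affine_dependent)
  have surj: "surj ((*v) J)"
    unfolding surj_def
  proof
    fix x
    define z where "z = x + c"
    define \<Delta> where "\<Delta> = cross2 (q - p) (r - p)"
    define u v w where "u = cross2 (r - q) (z - q) / \<Delta>" and "v = cross2 (p - r) (z - r) / \<Delta>"
      and "w = cross2 (q - p) (z - p) / \<Delta>"
    have "\<Delta> \<noteq> 0" using pqr(4) by (simp add: collinear_iff_cross2 \<Delta>_def)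
    then have z: "z = u *\<^sub>R p + v *\<^sub>R q + w *\<^sub>R r" "u + v + w = 1"
      using barycentric[of q p r z] by (simp_all add: u_def v_def w_def \<Delta>_def)
    have J: "J *v g p = p - c" "J *v g q = q - c" "J *v g r = r - c"
      using vert \<phi> pqr by (simp_all add: eq_diff_eq)
    \<comment> \<open>The weights sum to one, so exactly one copy of the translation
      \<open>c\<close> is removed from \<open>z\<close>.\<close>
    have "J *v (u *\<^sub>R g p + v *\<^sub>R g q + w *\<^sub>R g r) = z - (u + v + w) *\<^sub>R c"
      unfolding z(1) matrix_vector_right_distrib matrix_vector_mult_scaleR J by (simp add: algebra_simps)
    also have "\<dots> = x" by (simp add: z(2) z_def)
    finally show "\<exists>t. x = J *v t" by metis
  qed
  have inj: "inj ((*v) J)" using linear_surjective_imp_injective[OF lin surj] by simp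
  have img: "\<phi> ` X = (+) c ` ((*v) J ` X)" for X
    by (auto simp: image_image \<phi> add.commute)
  have "inj \<phi>" using inj by (auto simp: inj_def \<phi>)
  have "K = \<phi> ` g ` K" using vert by (simp add: image_image)
  then have "convex hull K = \<phi> ` (convex hull (g ` K))"
    by (metis img convex_hull_linear_image[OF lin] convex_hull_translation)
  then have "tri K = \<phi> ` interior (convex hull (g ` K))"
    unfolding tri_def by (simp only: img interior_translation interior_injective_linear_image[OF lin inj])
  then obtain z where "z \<in> interior (convex hull (g ` K))" "y = \<phi> z" using y by auto
  then show ?thesis using \<open>inj \<phi>\<close> by (simp add: inv_f_f)
qed

section \<open>Measurability of flux traces\<close>

text \<open>The set of points of \<open>e\<close> at which the limit exists is a relative \<open>G\<^sub>\<delta>\<close>, the limit is continuous on it,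
  and elsewhere \<^const>\<open>Lim\<close> is one and the same junk value. Hence no assumption on \<open>g\<close> is needed.\<close>

lemma borel_measurable_Lim_within:
  fixes g :: "'a::metric_space \<Rightarrow> 'b::{complete_space,real_normed_vector,second_countable_topology}"
  assumes e: "e \<in> sets borel" "e \<subseteq> closure T" "e \<inter> T = {}"
  shows "(\<lambda>x. Lim (at x within T) g) \<in> borel_measurable (restrict_space borel e)"
proof -
  define L where "L x = Lim (at x within T) g" for x
  \<comment> \<open>Points near which \<open>g\<close> oscillates by less than
    \<open>1 / (k + 1)\<close>. By completeness, lying in all of these open sets is the Cauchy
    criterion for existence of the limit.\<close>
  define W where "W k = {x. \<exists>\<delta>>0. \<forall>y\<in>T. \<forall>y'\<in>T. dist y x < \<delta> \<longrightarrow> dist y' x < \<delta> \<longrightarrow> dist (g y) (g y') < 1 / real (Suc k)}" for k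
  define G where "G = e \<inter> (\<Inter>k. W k)"
  \<comment> \<open>Disjointness of \<open>e\<close> from \<open>T\<close> turns points of the
    closure into limit points, so limits within \<open>T\<close> are unique.\<close>
  have nt: "at x within T \<noteq> bot" if "x \<in> e" for x
  proof -
    have "x islimpt T" using that e(2,3) by (auto simp: closure_def)
    then show ?thesis by (simp add: trivial_limit_within)
  qed
  have lim_G: "(g \<longlongrightarrow> L x) (at x within T)" if x: "x \<in> G" for x
  proof -
    have xe: "x \<in> e" using x by (simp add: G_def)
    have osc: "\<exists>\<delta>>0. \<forall>y\<in>T. \<forall>y'\<in>T. dist y x < \<delta> \<longrightarrow> dist y' x < \<delta> \<longrightarrow> dist (g y) (g y') < \<epsilon>" if "\<epsilon> > 0" for \<epsilon>
    proof -
      obtain k where k: "1 / real (Suc k) < \<epsilon>" using nat_approx_posE[OF \<open>\<epsilon> > 0\<close>] by blast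
      obtain \<delta> where "\<delta> > 0" "\<forall>y\<in>T. \<forall>y'\<in>T. dist y x < \<delta> \<longrightarrow> dist y' x < \<delta> \<longrightarrow> dist (g y) (g y') < 1 / real (Suc k)"
        using x unfolding G_def W_def by blast
      then show ?thesis using k by (intro exI[of _ \<delta>]) force
    qed
    obtain y where y: "\<And>k. y k \<in> T" "y \<longlonglongrightarrow> x"
      using subsetD[OF e(2) xe] unfolding closure_sequential by blast
    have yd: "\<exists>N. \<forall>k\<ge>N. dist (y k) x < \<delta>" if "\<delta> > 0" for \<delta>
      using y(2) that by (simp add: lim_sequentially)
    have "Cauchy (\<lambda>k. g (y k))"
    proof (rule metric_CauchyI)
      fix \<epsilon> :: real assume "\<epsilon> > 0"
      then obtain \<delta> where "\<delta> > 0" and \<delta>: "\<forall>y\<in>T. \<forall>y'\<in>T. dist y x < \<delta> \<longrightarrow> dist y' x < \<delta> \<longrightarrow> dist (g y) (g y') < \<epsilon>"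
        using osc by blast
      obtain N where "\<forall>k\<ge>N. dist (y k) x < \<delta>" using yd[OF \<open>\<delta> > 0\<close>] by blast
      then show "\<exists>N. \<forall>m\<ge>N. \<forall>k\<ge>N. dist (g (y m)) (g (y k)) < \<epsilon>" using \<delta> y(1) by (intro exI[of _ N]) simp
    qed
    then obtain l where l: "(\<lambda>k. g (y k)) \<longlonglongrightarrow> l" using Cauchy_convergent convergent_def by blast
    have gl: "(g \<longlongrightarrow> l) (at x within T)"
      unfolding Lim_within
    proof (intro allI impI)
      fix \<epsilon> :: real assume "\<epsilon> > 0"
      then have "\<epsilon> / 2 > 0" by simp
      then obtain \<delta> where "\<delta> > 0" and \<delta>: "\<forall>y\<in>T. \<forall>y'\<in>T. dist y x < \<delta> \<longrightarrow> dist y' x < \<delta> \<longrightarrow> dist (g y) (g y') < \<epsilon> / 2"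
        using osc by blast
      obtain N where N: "\<forall>k\<ge>N. dist (y k) x < \<delta>" using yd[OF \<open>\<delta> > 0\<close>] by blast
      obtain N' where N': "\<forall>k\<ge>N'. dist (g (y k)) l < \<epsilon> / 2"
        using l \<open>\<epsilon> / 2 > 0\<close> unfolding lim_sequentially by blast
      define k where "k = max N N'"
      have k: "dist (y k) x < \<delta>" "dist (g (y k)) l < \<epsilon> / 2" using N N' by (simp_all add: k_def)
      have "dist (g z) l < \<epsilon>" if "z \<in> T" "dist z x < \<delta>" for z
      proof -
        have "dist (g z) (g (y k)) < \<epsilon> / 2" using \<delta> that k(1) y(1) by simp
        then show ?thesis using k(2) dist_triangle[of "g z" l "g (y k)"] by linarith
      qed
      then show "\<exists>\<delta>>0. \<forall>z\<in>T. 0 < dist z x \<and> dist z x < \<delta> \<longrightarrow> dist (g z) l < \<epsilon>"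
        using \<open>\<delta> > 0\<close> by blast
    qed
    then show ?thesis unfolding L_def tendsto_Lim[OF nt[OF xe] gl] .
  qed
  have no_lim: "\<not> (g \<longlongrightarrow> l) (at x within T)" if x: "x \<in> e" "x \<notin> G" for x l
  proof
    assume lim: "(g \<longlongrightarrow> l) (at x within T)"
    have "x \<in> W k" for k
    proof -
      have "(0::real) < 1 / real (Suc k) / 2" by simp
      then obtain \<delta> where \<delta>: "\<delta> > 0" "\<forall>z\<in>T. 0 < dist z x \<and> dist z x < \<delta> \<longrightarrow> dist (g z) l < 1 / real (Suc k) / 2"
        using lim unfolding Lim_within by blast
      have close: "dist (g z) l < 1 / real (Suc k) / 2" if "z \<in> T" "dist z x < \<delta>" for z
      proof -
        have "z \<noteq> x" using that(1) x(1) e(3) by blast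
        then show ?thesis using \<delta>(2) that by simp
      qed
      have "dist (g z) (g z') < 1 / real (Suc k)" if "z \<in> T" "z' \<in> T" "dist z x < \<delta>" "dist z' x < \<delta>" for z z'
        using close[OF that(1,3)] close[OF that(2,4)] dist_triangle2[of "g z" "g z'" l] by linarith
      then show ?thesis unfolding W_def using \<delta>(1) by blast
    qed
    then show False using x by (simp add: G_def)
  qed
  have "open (W k)" for k
    unfolding open_dist
  proof
    fix x assume "x \<in> W k"
    then obtain \<delta> where \<delta>: "\<delta> > 0" "\<forall>y\<in>T. \<forall>y'\<in>T. dist y x < \<delta> \<longrightarrow> dist y' x < \<delta> \<longrightarrow> dist (g y) (g y') < 1 / real (Suc k)"
      by (auto simp: W_def)
    have "x' \<in> W k" if "dist x' x < \<delta> / 2" for x'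
    proof -
      have "dist y x < \<delta>" if "dist y x' < \<delta> / 2" for y
        using that \<open>dist x' x < \<delta> / 2\<close> dist_triangle[of y x x'] by linarith
      then show ?thesis unfolding W_def using \<delta> by (intro CollectI exI[of _ "\<delta> / 2"]) simp
    qed
    then show "\<exists>\<epsilon>>0. \<forall>y. dist y x < \<epsilon> \<longrightarrow> y \<in> W k" using \<delta>(1) by (intro exI[of _ "\<delta> / 2"]) simp
  qed
  then have "(\<Inter>k. W k) \<in> sets borel" by (intro sets.countable_INT) auto
  then have G: "G \<in> sets borel" unfolding G_def using e(1) by (rule sets.Int[rotated])
  have cont: "continuous_on G L"
    unfolding continuous_on_iff
  proof (intro ballI allI impI)
    fix x \<epsilon> assume x: "x \<in> G" and \<epsilon>: "(0::real) < \<epsilon>"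
    then have "0 < \<epsilon> / 2" by simp
    then obtain \<delta> where \<delta>: "\<delta> > 0" "\<forall>z\<in>T. 0 < dist z x \<and> dist z x < \<delta> \<longrightarrow> dist (g z) (L x) < \<epsilon> / 2"
      using lim_G[OF x] unfolding Lim_within by blast
    have "dist (L x') (L x) < \<epsilon>" if x': "x' \<in> G" "dist x' x < \<delta>" for x'
    proof -
      have xe: "x \<in> e" "x' \<in> e" using x x'(1) by (auto simp: G_def)
      \<comment> \<open>Points of \<open>T\<close> close to \<open>x'\<close> are also close to
        \<open>x\<close>. The non-strict half of \<epsilon> survives the passage to the limit at
        \<open>x'\<close>.\<close>
      have "\<forall>\<^sub>F z in at x' within T. dist (g z) (L x) \<le> \<epsilon> / 2"
        unfolding eventually_at
      proof (intro exI conjI ballI impI)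
        show "0 < \<delta> - dist x' x" using x'(2) by simp
        fix z assume z: "z \<in> T" "z \<noteq> x' \<and> dist z x' < \<delta> - dist x' x"
        have "dist z x < \<delta>" using z(2) dist_triangle[of z x x'] by linarith
        moreover have "z \<noteq> x" using z(1) xe(1) e(3) by blast
        ultimately show "dist (g z) (L x) \<le> \<epsilon> / 2" using \<delta>(2) z(1) by (simp add: less_imp_le)
      qed
      moreover have "((\<lambda>z. dist (g z) (L x)) \<longlongrightarrow> dist (L x') (L x)) (at x' within T)"
        by (intro tendsto_dist lim_G[OF x'(1)] tendsto_const)
      ultimately have "dist (L x') (L x) \<le> \<epsilon> / 2" using tendsto_upperbound nt[OF xe(2)] by blast
      then show ?thesis using \<epsilon> by linarith
    qed
    then show "\<exists>\<delta>>0. \<forall>x'\<in>G. dist x' x < \<delta> \<longrightarrow> dist (L x') (L x) < \<epsilon>" using \<delta>(1) by blast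
  qed
  \<comment> \<open>\<open>Lim\<close> unfolds to a definite description. Off \<open>G\<close> its
    predicate is constantly false, so its value does not depend on the point.\<close>
  define junk where "junk = (THE l::'b. False)"
  have "L x = indicator G x *\<^sub>R L x + indicator (- G) x *\<^sub>R junk" if "x \<in> e" for x
  proof (cases "x \<in> G")
    case False
    then have "L x = junk" unfolding L_def Topological_Spaces.Lim_def junk_def using no_lim[OF that] by simp
    then show ?thesis using False by simp
  qed simp
  moreover have "(\<lambda>x. indicator G x *\<^sub>R L x + indicator (- G) x *\<^sub>R junk) \<in> borel_measurable borel"
    using G by (intro borel_measurable_add borel_measurable_continuous_on_indicator[OF G cont]
        borel_measurable_scaleR borel_measurable_indicator borel_measurable_const) auto
  ultimately show ?thesis
    unfolding L_def[symmetric]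
    by (subst measurable_cong[where g = "\<lambda>x. indicator G x *\<^sub>R L x + indicator (- G) x *\<^sub>R junk"])
      (auto simp: space_restrict_space intro: measurable_restrict_space1)
qed

text \<open>This serves to replace the trace of \<eta> from one side of an interface by the almost
  everywhere equal trace from the other side in integrals against a discrete flux.\<close>

lemma borel_measurable_flux_trace:
  assumes "nondegenerate_triangle K" "e \<in> edges K"
  shows "flux_trace (tri K) A v \<in> borel_measurable (arclength e)"
proof -
  have "closed e" using assms(2) by (auto simp: edges_def)
  moreover have "e \<subseteq> closure (tri K)" "e \<inter> tri K = {}"
    using edge_subset_frontier_tri[OF assms] tri_convex_hull(1)[OF assms(1)]
    by (auto simp: frontier_def interior_open)
  ultimately show ?thesis
    unfolding flux_trace_def measurable_cong_sets[OF arclength_edge(2)[OF assms(2)] refl]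
    by (intro borel_measurable_Lim_within) auto
qed

section \<open>The error representation\<close>

lemma inner_symmetric_matrix:
  fixes M :: "real^'n^'n"
  assumes "transpose M = M"
  shows "(M *v x) \<bullet> y = (M *v y) \<bullet> x"
  by (metis assms dot_lmul_matrix inner_commute transpose_matrix_vector)

text \<open>The neighbour relation is symmetric. Writing the inner sums over all indices with a
  conditional makes the ranges independent, so that the order of summation can be exchanged.\<close>

lemma sum_nbrs_swap:
  fixes g :: "nat \<Rightarrow> nat \<Rightarrow> 'a::comm_monoid_add"
  shows "(\<Sum>d = 1..D. \<Sum>d'\<in>nbrs D K d. g d d') = (\<Sum>d = 1..D. \<Sum>d'\<in>nbrs D K d. g d' d)"
proof -
  have "(\<Sum>d'\<in>nbrs D K d. h d') = (\<Sum>d' = 1..D. if d' \<in> nbrs D K d then h d' else 0)"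
    for d and h :: "nat \<Rightarrow> 'a"
    by (subst sum.inter_restrict[symmetric]) (auto simp: nbrs_def intro!: sum.cong)
  note to_if = this
  have "(\<Sum>d = 1..D. \<Sum>d'\<in>nbrs D K d. g d d') = (\<Sum>d' = 1..D. \<Sum>d = 1..D. if d' \<in> nbrs D K d then g d d' else 0)"
    unfolding to_if by (rule sum.swap)
  also have "\<dots> = (\<Sum>d = 1..D. \<Sum>d'\<in>nbrs D K d. g d' d)"
    unfolding to_if by (intro sum.cong refl if_cong) (auto simp: nbrs_def)
  finally show ?thesis .
qed

lemma edge_pair_linear:
  assumes "integrable (arclength e) (\<lambda>x. f x * h x)" "integrable (arclength e) (\<lambda>x. g x * h x)"
  shows "edge_pair e (\<lambda>x. f x + g x) h = edge_pair e f h + edge_pair e g h"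
    and "edge_pair e (\<lambda>x. f x - g x) h = edge_pair e f h - edge_pair e g h"
  unfolding edge_pair_def using assms by (simp_all add: distrib_right left_diff_distrib)

lemma edge_pair_cmult: "edge_pair e (\<lambda>x. c * f x) h = c * edge_pair e f h"
  by (simp add: edge_pair_def mult.assoc)

theorem theorem2:
  fixes \<Omega> \<Omega>\<theta> \<Omega>s :: "(real^2) set"
    and D :: nat
    and K :: "nat \<Rightarrow> (real^2) set"
    and \<theta> :: "real^2 \<Rightarrow> real^2"
    and J :: "nat \<Rightarrow> real^2^2"
    and \<phi> :: "nat \<Rightarrow> real^2 \<Rightarrow> real^2"
    and a :: "real^2 \<Rightarrow> real^2^2"
    and a0 :: real
    and f \<psi> :: "real^2 \<Rightarrow> real"
    and A :: "nat \<Rightarrow> real^2 \<Rightarrow> real^2^2"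
    and F \<psi>t :: "nat \<Rightarrow> real^2 \<Rightarrow> real"
    and u \<eta> :: "real^2 \<Rightarrow> real"
    and t\<eta> q\<eta> :: "nat \<Rightarrow> real^2 \<Rightarrow> real"
    and \<T> :: "(real^2) set set"
    and lam :: real
    and I :: nat
    and U :: "nat \<Rightarrow> nat \<Rightarrow> real^2 \<Rightarrow> real"
    and n :: "nat \<Rightarrow> nat \<Rightarrow> real^2"
    and flux :: "nat \<Rightarrow> nat \<Rightarrow> real^2 \<Rightarrow> real^2"
    and i :: nat
  \<comment> \<open>reference domain and its perturbation\<close>
  assumes \<Omega>: "convex_polygonal_domain \<Omega>"
    and \<Omega>s: "convex_polygonal_domain \<Omega>s" "\<Omega> \<subseteq> \<Omega>s" "\<Omega>\<theta> \<subseteq> \<Omega>s"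
    and K: "inj_on K {1..D}" "conforming_triangulation \<Omega> (K ` {1..D})"
    and \<Omega>\<theta>: "\<Omega>\<theta> = interior (\<Union>d\<in>{1..D}. convex hull (perturbed_node \<Omega> \<theta> ` K d))" "connected \<Omega>\<theta>"
    and K\<theta>: "inj_on (\<lambda>d. perturbed_node \<Omega> \<theta> ` K d) {1..D}"
      "triangle_partition \<Omega>\<theta> ((\<lambda>d. perturbed_node \<Omega> \<theta> ` K d) ` {1..D})"
    and \<phi>: "\<And>d. d \<in> {1..D} \<Longrightarrow> \<exists>c. \<forall>x. \<phi> d x = J d *v x + c"
      "\<And>d p. d \<in> {1..D} \<Longrightarrow> p \<in> K d \<Longrightarrow> \<phi> d (perturbed_node \<Omega> \<theta> p) = p"
  \<comment> \<open>data\<close>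
    and a: "a0 > 0" "continuous_on \<Omega>s a" "\<And>x. x \<in> \<Omega>s \<Longrightarrow> transpose (a x) = a x"
      "\<And>x w. x \<in> \<Omega>s \<Longrightarrow> w \<bullet> (a x *v w) \<ge> a0 * (norm w)\<^sup>2"
    and f: "continuous_on \<Omega>s f"
    and \<psi>: "L2 (lebesgue_on \<Omega>s) \<psi>"
    and A: "\<And>d. A d = transformed_matrix (J d) (\<phi> d) a"
    and F: "\<And>d. F d = transformed_scalar (J d) (\<phi> d) f"
    and \<psi>t: "\<And>d. \<psi>t d = transformed_scalar (J d) (\<phi> d) \<psi>"
  \<comment> \<open>transformed problem\<close>
    and u: "weak_solution \<Omega> (glue D K A) (glue D K F) u"
  \<comment> \<open>adjoint problem, with the trace and the normal flux of its solution on each subdomain\<close>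
    and \<eta>: "weak_solution \<Omega> (glue D K A) (glue D K \<psi>t) \<eta>"
    and t\<eta>: "\<And>d. d \<in> {1..D} \<Longrightarrow> has_trace (K d) \<eta> (t\<eta> d)"
      "\<And>d d'. d \<in> {1..D} \<Longrightarrow> d' \<in> nbrs D K d \<Longrightarrow>
         AE x in arclength (iface K d d'). t\<eta> d x = t\<eta> d' x"
    and q\<eta>: "\<And>d. d \<in> {1..D} \<Longrightarrow>
         has_normal_trace (K d) (\<lambda>y. A d y *v wgrad \<Omega> \<eta> y) (\<lambda>y. - \<psi>t d y) (q\<eta> d)"
      "\<And>d d'. d \<in> {1..D} \<Longrightarrow> d' \<in> nbrs D K d \<Longrightarrow>
         AE x in arclength (iface K d d'). q\<eta> d x = - q\<eta> d' x"
  \<comment> \<open>discrete Lions algorithm\<close>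
    and \<T>: "conforming_triangulation \<Omega> \<T>" "mesh_refines \<T> (K ` {1..D})"
    and lam: "lam \<ge> 0"
    and U0: "\<And>d. d \<in> {1..D} \<Longrightarrow> U 0 d \<in> Vh \<Omega> \<T> (K d)"
    and U: "\<And>j. j \<in> {1..I} \<Longrightarrow> lions_step \<Omega> D K \<T> A F lam (U (j - 1)) (U j)"
    and n: "\<And>d d'. n d d' = outward_normal (tri (K d)) (iface K d d')"
    and flux: "\<And>j d. flux j d = flux_trace (tri (K d)) (A d) (U j d)"
  \<comment> \<open>the interface integrals of the discrete fluxes against the adjoint solution are well defined\<close>
    and flux_integrable: "\<And>j d d'. j \<in> {0..I} \<Longrightarrow> d \<in> {1..D} \<Longrightarrow> d' \<in> nbrs D K d \<Longrightarrow>
         integrable (arclength (iface K d d')) (\<lambda>x. (n d d' \<bullet> flux j d x) * t\<eta> d x)"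
    and i: "i \<in> {1..I}"
  shows "qoi \<Omega> (glue D K \<psi>t) (\<lambda>y. u y - glue D K (U i) y) =
    \<comment> \<open>discretization error\<close>
    (\<Sum>d = 1..D.
        dom_pair (tri (K d)) (F d) \<eta>
        - dom_pair (tri (K d)) (\<lambda>y. A d y *v grad (U i d) y) (wgrad \<Omega> \<eta>)
        + (\<Sum>d'\<in>nbrs D K d.
             edge_pair (iface K d d')
               (\<lambda>x. - lam * U i d x + lam * U (i - 1) d' x - n d' d \<bullet> flux (i - 1) d' x) (t\<eta> d)))
    \<comment> \<open>iteration error\<close>
    + (\<Sum>d = 1..D. \<Sum>d'\<in>nbrs D K d.
        edge_pair (iface K d d') (\<lambda>x. lam * U i d x - lam * U (i - 1) d x) (t\<eta> d)
        + edge_pair (iface K d d') (\<lambda>x. n d d' \<bullet> flux (i - 1) d x - n d d' \<bullet> flux i d x) (t\<eta> d))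
    \<comment> \<open>consistency error\<close>
    + (1 / 2) * (\<Sum>d = 1..D. \<Sum>d'\<in>nbrs D K d.
        edge_pair (iface K d d') (\<lambda>x. n d d' \<bullet> flux i d x - n d d' \<bullet> flux i d' x) (t\<eta> d)
        + edge_pair (iface K d d') (q\<eta> d) (\<lambda>x. U i d x - U i d' x))"
proof -
  note conf = K(2) K(1)
  note nd = conforming_indexedD(1)[OF conf]
  have open\<Omega>: "open \<Omega>" using \<Omega> by (simp add: convex_polygonal_domain_def)
  have U_Vh: "U j d \<in> Vh \<Omega> \<T> (K d)" if "j \<in> {0..I}" "d \<in> {1..D}" for j d
  proof (cases "j = 0")
    case False
    then show ?thesis using U[of j] that by (simp add: lions_step_def)
  qed (use U0 that in simp)
  have U_cont: "continuous_on (closure (tri (K d))) (U j d)" if "j \<in> {0..I}" "d \<in> {1..D}" for j d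
    using U_Vh[OF that] by (simp add: Vh_def)
  have U_H1: "H1_grad (tri (K d)) (U j d) (grad (U j d))" if "j \<in> {0..I}" "d \<in> {1..D}" for j d
    by (rule Vh_H1_grad[OF K(2) \<T>]) (use U_Vh[OF that] that in auto)
  have U_L2: "L2 (arclength e) (U j d)" if "j \<in> {0..I}" "d \<in> {1..D}" "e \<in> edges (K d)" for j d e
    using edge_subset_frontier_tri[OF nd[OF that(2)] that(3)]
    by (intro L2_arclength_continuous[OF that(3)] continuous_on_subset[OF U_cont[OF that(1,2)]])
      (auto simp: frontier_def)
  have t_L2: "L2 (arclength e) (t\<eta> d)" if "d \<in> {1..D}" "e \<in> edges (K d)" for d e
    using t\<eta>(1)[OF that(1)] that(2) by (auto simp: has_trace_def L2_tendsto_def)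
  have q_L2: "L2 (arclength e) (q\<eta> d)" if "d \<in> {1..D}" "e \<in> edges (K d)" for d e
    using q\<eta>(1)[OF that(1)] that(2) by (auto simp: has_normal_trace_def)
  \<comment> \<open>Square integrability of the divergence is part of having a normal trace; it
    provides integrability of the product with the discrete function, needed to split
    \<open>Q\<close>.\<close>
  have \<psi>_L2: "L2 (lebesgue_on (tri (K d))) (\<lambda>y. - \<psi>t d y)" if "d \<in> {1..D}" for d
    using q\<eta>(1)[OF that] by (auto simp: has_normal_trace_def)
  have j: "i \<in> {0..I}" "i - 1 \<in> {0..I}" using i by auto
  have space_tri: "space (lebesgue_on (tri (K d))) = tri (K d)" for d by simp

  \<comment> \<open>Symmetry of \<open>a\<close> is given only on \<open>\<Omega>s\<close>, so the
    preimage of \<open>y\<close> has to be located in the perturbed domain.\<close>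
  have A_sym: "transpose (A d y) = A d y" if d: "d \<in> {1..D}" and y: "y \<in> tri (K d)" for d y
  proof -
    obtain c where c: "\<And>x. \<phi> d x = J d *v x + c" using \<phi>(1)[OF d] by blast
    have "inv (\<phi> d) y \<in> interior (convex hull (perturbed_node \<Omega> \<theta> ` K d))"
      by (rule inv_affine_tri[OF nd[OF d] c \<phi>(2)[OF d] y])
    also have "\<dots> \<subseteq> \<Omega>\<theta>" unfolding \<Omega>\<theta>(1) using d by (intro interior_mono) auto
    finally have "inv (\<phi> d) y \<in> \<Omega>s" using \<Omega>s(3) by auto
    then show ?thesis unfolding A by (intro transpose_transformed_matrix a(3))
  qed
  \<comment> \<open>Off the open triangles the glued matrix is zero. Symmetry therefore holds at
    every point and can be used by rewriting under the integral.\<close>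
  have glue_sym: "transpose (glue D K A y) = glue D K A y" for y
  proof (cases "\<exists>d\<in>{1..D}. y \<in> tri (K d)")
    case True
    then obtain d where d: "d \<in> {1..D}" "y \<in> tri (K d)" by blast
    then show ?thesis using A_sym[OF d] by (simp add: glue_tri[OF conf d])
  next
    case False
    then show ?thesis by (simp add: glue_def transpose_def vec_eq_iff)
  qed

  \<comment> \<open>Each solution is an admissible test function for the problem of the
    other.\<close>
  have "u \<in> H10 \<Omega>" "\<eta> \<in> H10 \<Omega>" using u \<eta> by (simp_all add: weak_solution_def)
  then have weak:
    "integrable (lebesgue_on \<Omega>) (\<lambda>y. glue D K F y * \<eta> y)"
    "integrable (lebesgue_on \<Omega>) (\<lambda>y. glue D K \<psi>t y * u y)"
    "(\<integral>y. (glue D K A y *v wgrad \<Omega> u y) \<bullet> wgrad \<Omega> \<eta> y \<partial>lebesgue_on \<Omega>) = (\<integral>y. glue D K F y * \<eta> y \<partial>lebesgue_on \<Omega>)"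
    "(\<integral>y. (glue D K A y *v wgrad \<Omega> \<eta> y) \<bullet> wgrad \<Omega> u y \<partial>lebesgue_on \<Omega>) = (\<integral>y. glue D K \<psi>t y * u y \<partial>lebesgue_on \<Omega>)"
    using u \<eta> by (simp_all add: weak_solution_def)
  have "(\<integral>y. glue D K \<psi>t y * u y \<partial>lebesgue_on \<Omega>) = (\<integral>y. glue D K F y * \<eta> y \<partial>lebesgue_on \<Omega>)"
    unfolding weak(3,4)[symmetric] by (simp only: inner_symmetric_matrix[OF glue_sym])
  also have "\<dots> = (\<Sum>d = 1..D. dom_pair (tri (K d)) (F d) \<eta>)"
    unfolding lebesgue_on_triangle_partition(2)[OF \<Omega> conf weak(1)] dom_pair_def
    by (intro sum.cong Bochner_Integration.integral_cong refl) (simp add: glue_tri[OF conf])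
  finally have Q_u: "(\<integral>y. u y * glue D K \<psi>t y \<partial>lebesgue_on \<Omega>) = (\<Sum>d = 1..D. dom_pair (tri (K d)) (F d) \<eta>)"
    by (simp add: mult.commute)

  \<comment> \<open>Volume terms of the quantity of interest\<close>
  have U\<psi>: "integrable (lebesgue_on (tri (K d))) (\<lambda>y. U i d y * \<psi>t d y)" if "d \<in> {1..D}" for d
  proof -
    have "integrable (lebesgue_on (tri (K d))) (\<lambda>y. U i d y * - \<psi>t d y)"
      using U_H1[OF j(1) that] by (intro L2_mult_integrable \<psi>_L2[OF that]) (simp add: H1_grad_def)
    then show ?thesis by simp
  qed
  have glue_U\<psi>: "integrable (lebesgue_on \<Omega>) (\<lambda>y. glue D K (U i) y * glue D K \<psi>t y)"
    unfolding lebesgue_on_triangle_partition(1)[OF \<Omega> conf]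
  proof
    fix d assume d: "d \<in> {1..D}"
    show "integrable (lebesgue_on (tri (K d))) (\<lambda>y. glue D K (U i) y * glue D K \<psi>t y)"
      using U\<psi>[OF d]
      by (rule iffD1[OF Bochner_Integration.integrable_cong[OF refl], rotated]) (simp add: glue_tri[OF conf d])
  qed
  have Q_U: "(\<integral>y. glue D K (U i) y * glue D K \<psi>t y \<partial>lebesgue_on \<Omega>) =
      (\<Sum>d = 1..D. dom_pair (tri (K d)) (U i d) (\<psi>t d))"
    unfolding lebesgue_on_triangle_partition(2)[OF \<Omega> conf glue_U\<psi>] dom_pair_def
    by (intro sum.cong Bochner_Integration.integral_cong refl) (simp add: glue_tri[OF conf])
  have "qoi \<Omega> (glue D K \<psi>t) (\<lambda>y. u y - glue D K (U i) y) =
      (\<integral>y. u y * glue D K \<psi>t y - glue D K (U i) y * glue D K \<psi>t y \<partial>lebesgue_on \<Omega>)"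
    by (simp add: qoi_def left_diff_distrib)
  also have "\<dots> = (\<Sum>d = 1..D. dom_pair (tri (K d)) (F d) \<eta>) - (\<Sum>d = 1..D. dom_pair (tri (K d)) (U i d) (\<psi>t d))"
    unfolding Q_u[symmetric] Q_U[symmetric] using weak(2) glue_U\<psi>
    by (intro Bochner_Integration.integral_diff) (simp_all add: mult.commute)
  finally have Q: "qoi \<Omega> (glue D K \<psi>t) (\<lambda>y. u y - glue D K (U i) y) =
      (\<Sum>d = 1..D. dom_pair (tri (K d)) (F d) \<eta>) - (\<Sum>d = 1..D. dom_pair (tri (K d)) (U i d) (\<psi>t d))" .

  \<comment> \<open>Green's formula on each subdomain\<close>
  define s where "s d d' = edge_pair (iface K d d') (q\<eta> d) (U i d)" for d d'
  have green: "dom_pair (tri (K d)) (U i d) (\<psi>t d) =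
      dom_pair (tri (K d)) (\<lambda>y. A d y *v grad (U i d) y) (wgrad \<Omega> \<eta>) - (\<Sum>d'\<in>nbrs D K d. s d d')"
    if d: "d \<in> {1..D}" for d
  proof -
    have "dom_pair (tri (K d)) (\<lambda>y. A d y *v wgrad \<Omega> \<eta> y) (grad (U i d)) + dom_pair (tri (K d)) (\<lambda>y. - \<psi>t d y) (U i d)
        = (\<Sum>e\<in>edges (K d). edge_pair e (q\<eta> d) (U i d))"
    proof -
      have "\<forall>v g t. H1_grad (tri (K d)) v g \<and> has_trace (K d) v t \<longrightarrow>
          dom_pair (tri (K d)) (\<lambda>y. A d y *v wgrad \<Omega> \<eta> y) g + dom_pair (tri (K d)) (\<lambda>y. - \<psi>t d y) v
          = (\<Sum>e\<in>edges (K d). edge_pair e (q\<eta> d) t)"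
        using q\<eta>(1)[OF d] by (simp add: has_normal_trace_def)
      \<comment> \<open>The discrete function is continuous up to the boundary and thus its own
        trace.\<close>
      then show ?thesis
        using U_H1[OF j(1) d] H1_has_trace[OF nd[OF d] U_H1[OF j(1) d] U_cont[OF j(1) d]] by blast
    qed
    also have "\<dots> = (\<Sum>d'\<in>nbrs D K d. s d d')"
      unfolding s_def
    proof (rule sum_edges_eq_sum_nbrs[OF open\<Omega> conf d])
      fix e assume e: "e \<in> edges (K d)" "e \<subseteq> frontier \<Omega>"
      have "U i d x = 0" if "x \<in> e" for x
      proof -
        have "x \<in> frontier (tri (K d)) \<inter> frontier \<Omega>"
          using edge_subset_frontier_tri[OF nd[OF d] e(1)] e(2) that by auto
        then show ?thesis using U_Vh[OF j(1) d] by (simp add: Vh_def)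
      qed
      then have "edge_pair e (q\<eta> d) (U i d) = (\<integral>x. 0 \<partial>arclength e)"
        unfolding edge_pair_def by (intro Bochner_Integration.integral_cong) (auto simp: arclength_edge(1)[OF e(1)])
      then show "edge_pair e (q\<eta> d) (U i d) = 0" by simp
    qed
    also have "dom_pair (tri (K d)) (\<lambda>y. A d y *v wgrad \<Omega> \<eta> y) (grad (U i d)) =
        dom_pair (tri (K d)) (\<lambda>y. A d y *v grad (U i d) y) (wgrad \<Omega> \<eta>)"
      unfolding dom_pair_def
      by (intro Bochner_Integration.integral_cong refl)
        (simp add: inner_symmetric_matrix[OF A_sym[OF d]])
    also have "dom_pair (tri (K d)) (\<lambda>y. - \<psi>t d y) (U i d) = - dom_pair (tri (K d)) (U i d) (\<psi>t d)"
      by (simp add: dom_pair_def mult.commute)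
    finally show ?thesis by simp
  qed

  \<comment> \<open>\<open>b\<close> and \<open>fl\<close> are one-sided: every ingredient is taken
    from the subdomain of the first index. Exchanging the indices then expresses a term as seen from
    the neighbour.\<close>
  define b where "b k d d' = edge_pair (iface K d d') (U k d) (t\<eta> d)" for k d d'
  define fl where "fl k d d' = edge_pair (iface K d d') (\<lambda>x. n d d' \<bullet> flux k d x) (t\<eta> d)" for k d d'
  have iface_terms:
    "edge_pair (iface K d d') (\<lambda>x. - lam * U i d x + lam * U (i - 1) d' x - n d' d \<bullet> flux (i - 1) d' x) (t\<eta> d)
      = - lam * b i d d' + lam * b (i - 1) d' d - fl (i - 1) d' d"
    "edge_pair (iface K d d') (\<lambda>x. lam * U i d x - lam * U (i - 1) d x) (t\<eta> d) = lam * b i d d' - lam * b (i - 1) d d'"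
    "edge_pair (iface K d d') (\<lambda>x. n d d' \<bullet> flux (i - 1) d x - n d d' \<bullet> flux i d x) (t\<eta> d) = fl (i - 1) d d' - fl i d d'"
    "edge_pair (iface K d d') (\<lambda>x. n d d' \<bullet> flux i d x - n d d' \<bullet> flux i d' x) (t\<eta> d) = fl i d d' + fl i d' d"
    "edge_pair (iface K d d') (q\<eta> d) (\<lambda>x. U i d x - U i d' x) = s d d' + s d' d"
    if d: "d \<in> {1..D}" and d': "d' \<in> nbrs D K d" for d d'
  proof -
    let ?e = "iface K d d'"
    note nb = nbr_iface[OF conf d d'] and d_nb = nbrs_sym[OF d d'] and comm = iface_commute[of K d' d]
    have nn: "n d' d = - n d d'" unfolding n by (rule nb(5))
    have t_eq: "AE x in arclength ?e. t\<eta> d' x = t\<eta> d x" using t\<eta>(2)[OF d d'] by eventually_elim simp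
    have t_meas [measurable]: "t\<eta> d \<in> borel_measurable (arclength ?e)" "t\<eta> d' \<in> borel_measurable (arclength ?e)"
      using t_L2[OF d nb(3)] t_L2[OF nb(1,4)] by (simp_all add: L2_def)
    have int_U: "integrable (arclength ?e) (\<lambda>x. U k d x * t\<eta> d x)" "integrable (arclength ?e) (\<lambda>x. U k d' x * t\<eta> d x)"
      if "k \<in> {0..I}" for k
      using U_L2[OF that] t_L2 d nb by (auto intro!: L2_mult_integrable)
    have int_fl: "integrable (arclength ?e) (\<lambda>x. (n d d' \<bullet> flux k d x) * t\<eta> d x)" if "k \<in> {0..I}" for k
      by (rule flux_integrable[OF that d d'])
    \<comment> \<open>The integrability assumption from the neighbour's side involves
      \<open>t\<eta> d'\<close>; measurability of the flux allows the passage to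
      \<open>t\<eta> d\<close>.\<close>
    have int_fl': "integrable (arclength ?e) (\<lambda>x. (n d' d \<bullet> flux k d' x) * t\<eta> d x)"
      and fl': "edge_pair ?e (\<lambda>x. n d' d \<bullet> flux k d' x) (t\<eta> d) = fl k d' d" if "k \<in> {0..I}" for k
    proof -
      have int: "integrable (arclength ?e) (\<lambda>x. (n d' d \<bullet> flux k d' x) * t\<eta> d' x)"
        using flux_integrable[OF that nb(1) d_nb] by (simp add: comm)
      have ae: "AE x in arclength ?e. (n d' d \<bullet> flux k d' x) * t\<eta> d' x = (n d' d \<bullet> flux k d' x) * t\<eta> d x"
        using t_eq by eventually_elim simp
      have [measurable]: "flux k d' \<in> borel_measurable (arclength ?e)"
        unfolding flux by (rule borel_measurable_flux_trace[OF nd[OF nb(1)] nb(4)])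
      show "integrable (arclength ?e) (\<lambda>x. (n d' d \<bullet> flux k d' x) * t\<eta> d x)"
        by (rule integrable_cong_AE_imp[OF int _ ae]) measurable
      show "edge_pair ?e (\<lambda>x. n d' d \<bullet> flux k d' x) (t\<eta> d) = fl k d' d"
        unfolding fl_def comm edge_pair_def using ae by (intro integral_cong_AE) auto
    qed
    have b': "edge_pair ?e (U k d') (t\<eta> d) = b k d' d" if "k \<in> {0..I}" for k
    proof -
      have [measurable]: "U k d' \<in> borel_measurable (arclength ?e)"
        using U_L2[OF that nb(1,4)] by (simp add: L2_def)
      show ?thesis
        unfolding b_def comm edge_pair_def using t_eq by (intro integral_cong_AE) auto
    qed
    have int_q: "integrable (arclength ?e) (\<lambda>x. q\<eta> d x * U i d x)" "integrable (arclength ?e) (\<lambda>x. q\<eta> d x * U i d' x)"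
      using U_L2[OF j(1)] q_L2 d nb by (auto intro!: L2_mult_integrable)
    \<comment> \<open>The sign comes from the continuity of the normal flux of \<eta>, expressed
      with the opposite outward normals.\<close>
    have q': "edge_pair ?e (q\<eta> d) (U i d') = - s d' d"
    proof -
      have [measurable]: "U i d' \<in> borel_measurable (arclength ?e)" "q\<eta> d \<in> borel_measurable (arclength ?e)"
        "q\<eta> d' \<in> borel_measurable (arclength ?e)"
        using U_L2[OF j(1) nb(1,4)] q_L2[OF d nb(3)] q_L2[OF nb(1,4)] by (simp_all add: L2_def)
      have "edge_pair ?e (q\<eta> d) (U i d') = (\<integral>x. - (q\<eta> d' x * U i d' x) \<partial>arclength ?e)"
        unfolding edge_pair_def using q\<eta>(2)[OF d d'] by (intro integral_cong_AE) auto
      then show ?thesis by (simp add: s_def comm edge_pair_def)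
    qed
    note lin = edge_pair_linear[where e = ?e] and scal = edge_pair_cmult[where e = ?e]
    show "edge_pair ?e (\<lambda>x. - lam * U i d x + lam * U (i - 1) d' x - n d' d \<bullet> flux (i - 1) d' x) (t\<eta> d)
      = - lam * b i d d' + lam * b (i - 1) d' d - fl (i - 1) d' d"
    proof -
      have i1: "integrable (arclength ?e) (\<lambda>x. (- lam * U i d x) * t\<eta> d x)"
        "integrable (arclength ?e) (\<lambda>x. (lam * U (i - 1) d' x) * t\<eta> d x)"
        using int_U(1)[OF j(1)] int_U(2)[OF j(2)] by (simp_all add: mult.assoc)
      then have i2: "integrable (arclength ?e) (\<lambda>x. (- lam * U i d x + lam * U (i - 1) d' x) * t\<eta> d x)"
        unfolding distrib_right by (rule Bochner_Integration.integrable_add)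
      show ?thesis
        unfolding lin(2)[OF i2 int_fl'[OF j(2)]] lin(1)[OF i1] scal b'[OF j(2)] fl'[OF j(2)] b_def ..
    qed
    show "edge_pair ?e (\<lambda>x. lam * U i d x - lam * U (i - 1) d x) (t\<eta> d) = lam * b i d d' - lam * b (i - 1) d d'"
    proof -
      have i1: "integrable (arclength ?e) (\<lambda>x. (lam * U i d x) * t\<eta> d x)"
        "integrable (arclength ?e) (\<lambda>x. (lam * U (i - 1) d x) * t\<eta> d x)"
        using int_U(1)[OF j(1)] int_U(1)[OF j(2)] by (simp_all add: mult.assoc)
      show ?thesis unfolding lin(2)[OF i1] scal b_def ..
    qed
    show "edge_pair ?e (\<lambda>x. n d d' \<bullet> flux (i - 1) d x - n d d' \<bullet> flux i d x) (t\<eta> d) = fl (i - 1) d d' - fl i d d'"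
      unfolding lin(2)[OF int_fl[OF j(2)] int_fl[OF j(1)]] fl_def ..
    show "edge_pair ?e (\<lambda>x. n d d' \<bullet> flux i d x - n d d' \<bullet> flux i d' x) (t\<eta> d) = fl i d d' + fl i d' d"
    proof -
      have "edge_pair ?e (\<lambda>x. n d d' \<bullet> flux i d x - n d d' \<bullet> flux i d' x) (t\<eta> d) =
          edge_pair ?e (\<lambda>x. n d d' \<bullet> flux i d x + n d' d \<bullet> flux i d' x) (t\<eta> d)"
        by (simp add: nn)
      also have "\<dots> = fl i d d' + fl i d' d"
        unfolding lin(1)[OF int_fl[OF j(1)] int_fl'[OF j(1)]] fl'[OF j(1)] by (simp add: fl_def)
      finally show ?thesis .
    qed
    show "edge_pair ?e (q\<eta> d) (\<lambda>x. U i d x - U i d' x) = s d d' + s d' d"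
    proof -
      have "edge_pair ?e (q\<eta> d) (\<lambda>x. U i d x - U i d' x) = s d d' - edge_pair ?e (q\<eta> d) (U i d')"
        unfolding edge_pair_def s_def right_diff_distrib by (rule Bochner_Integration.integral_diff[OF int_q])
      then show ?thesis using q' by simp
    qed
  qed

  \<comment> \<open>Cancellation of the double sums\<close>
  let ?S = "\<lambda>g. \<Sum>d = 1..D. \<Sum>d'\<in>nbrs D K d. g d d' :: real"
  have swap: "?S (\<lambda>d d'. g d' d) = ?S g" for g by (rule sum_nbrs_swap[symmetric])
  have DE: "(\<Sum>d = 1..D.
        dom_pair (tri (K d)) (F d) \<eta>
        - dom_pair (tri (K d)) (\<lambda>y. A d y *v grad (U i d) y) (wgrad \<Omega> \<eta>)
        + (\<Sum>d'\<in>nbrs D K d.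
             edge_pair (iface K d d')
               (\<lambda>x. - lam * U i d x + lam * U (i - 1) d' x - n d' d \<bullet> flux (i - 1) d' x) (t\<eta> d))) =
      (\<Sum>d = 1..D. dom_pair (tri (K d)) (F d) \<eta>)
      - (\<Sum>d = 1..D. dom_pair (tri (K d)) (\<lambda>y. A d y *v grad (U i d) y) (wgrad \<Omega> \<eta>))
      + ?S (\<lambda>d d'. - lam * b i d d' + lam * b (i - 1) d' d - fl (i - 1) d' d)"
    by (simp only: sum.distrib sum_subtractf iface_terms(1) cong: sum.cong)
  have DE_iface: "?S (\<lambda>d d'. - lam * b i d d' + lam * b (i - 1) d' d - fl (i - 1) d' d)
      = - lam * ?S (b i) + lam * ?S (b (i - 1)) - ?S (fl (i - 1))"
    unfolding sum.distrib sum_subtractf swap[of "fl (i - 1)"] swap[of "\<lambda>d d'. lam * b (i - 1) d d'"]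
    by (simp add: sum_distrib_left)
  have IE: "(\<Sum>d = 1..D. \<Sum>d'\<in>nbrs D K d.
        edge_pair (iface K d d') (\<lambda>x. lam * U i d x - lam * U (i - 1) d x) (t\<eta> d)
        + edge_pair (iface K d d') (\<lambda>x. n d d' \<bullet> flux (i - 1) d x - n d d' \<bullet> flux i d x) (t\<eta> d)) =
      lam * ?S (b i) - lam * ?S (b (i - 1)) + ?S (fl (i - 1)) - ?S (fl i)"
    by (simp only: iface_terms(2,3) cong: sum.cong)
      (simp add: sum.distrib sum_subtractf sum_distrib_left)
  have CE: "(\<Sum>d = 1..D. \<Sum>d'\<in>nbrs D K d.
        edge_pair (iface K d d') (\<lambda>x. n d d' \<bullet> flux i d x - n d d' \<bullet> flux i d' x) (t\<eta> d)
        + edge_pair (iface K d d') (q\<eta> d) (\<lambda>x. U i d x - U i d' x)) = 2 * ?S (fl i) + 2 * ?S s"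
    using swap[of "fl i"] swap[of s] by (simp only: iface_terms(4,5) sum.distrib cong: sum.cong)
  have vol: "(\<Sum>d = 1..D. dom_pair (tri (K d)) (U i d) (\<psi>t d)) =
      (\<Sum>d = 1..D. dom_pair (tri (K d)) (\<lambda>y. A d y *v grad (U i d) y) (wgrad \<Omega> \<eta>)) - ?S s"
    by (simp add: green sum_subtractf)
  \<comment> \<open>In the discretization and iteration errors the terms with \<lambda> and those
    with the previous flux cancel, leaving \<open>- ?S (fl i)\<close>. Half of \<open>CE\<close>
    adds \<open>?S (fl i) + ?S s\<close>, and the surviving \<open>?S s\<close> is the interface
    part of Green's formula in \<open>vol\<close>.\<close>
  show ?thesis unfolding Q DE DE_iface IE CE vol by (simp add: field_simps)
qed

end
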